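(* Consider the online time-critical task scheduling with calibration problem with unit processing time jobs, activation time $\lambda$ (a nonnegative integer) and calibrated length $T$. There exists a deterministic online algorithm for this problem with competitive ratio $3(e+1)\lambda+3e+7$. In particular, for the special case $\lambda=0$ there exists a deterministic online algorithm with competitive ratio $3e+7\ (\approx 15.16)$.
   Context: Problem (online time-critical task scheduling with calibration, unit processing times): There is an unlimited number of identical machines. Time is discrete (integer time steps). A calibration started at integer time $t$ occupies a machine during $[t,t+\lambda+T)$: the interval $[t,t+\lambda)$ is the activation (calibrating) interval, and $[t+\lambda,t+\lambda+T)$ is the calibrated interval. A machine can process jobs only while calibrated, and processes at most one job at a time. Each job $j$ has integer release time $r_j$, processing time $p_j=1$, and integer deadline $d_j$, with $d_j-r_j\ge 1+\lambda$. A job scheduled at integer time $t$ occupies one calibrated slot $[t,t+1)$ of some calibration and is feasibly scheduled iff $r_j\le t$ and $t+1\le d_j$. Jobs arrive online: the algorithm learns job $j$ only at time $r_j$; at each time step it may start calibrations at the current time and schedule released jobs at the current time (decisions cannot be made retroactively). The objective is to minimize the total number of calibrations while feasibly scheduling all jobs. An online algorithm ALG is $c$-competitive if there is a constant $a$ such that for every instance $Ins$, $ALG(Ins)\le c\cdot OPT(Ins)+a$, where $ALG(Ins)$ is the number of calibrations used by the algorithm and $OPT(Ins)$ the minimum possible number of calibrations for $Ins$. *)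

theory Defs
  imports Complex_Main
begin

text \<open>
  The identifier only serves to allow several jobs with the same release time and deadline
  in one instance.
\<close>

record job =
  jid :: nat
  release :: int
  deadline :: int

definition valid_instance :: "nat \<Rightarrow> job set \<Rightarrow> bool" where
  "valid_instance lam J \<longleftrightarrow>
     finite J \<and> (\<forall>j\<in>J. deadline j - release j \<ge> 1 + int lam)"

text \<open>
  Machines are numbered by the natural numbers. A pair \<open>(m, s)\<close> in \<open>cals\<close> is a calibration of
  machine \<open>m\<close> started at time \<open>s\<close>; a triple \<open>(j, m, t)\<close> in \<open>runs\<close> says that job \<open>j\<close> is processed
  on machine \<open>m\<close> during \<open>[t, t + 1)\<close>.
\<close>

record schedule =
  cals :: "(nat \<times> int) set"
  runs :: "(job \<times> nat \<times> int) set"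

definition occupied :: "nat \<Rightarrow> nat \<Rightarrow> int \<Rightarrow> int set" where
  "occupied lam T s = {s ..< s + int lam + int T}"

definition calibrated :: "nat \<Rightarrow> nat \<Rightarrow> int \<Rightarrow> int set" where
  "calibrated lam T s = {s + int lam ..< s + int lam + int T}"

definition feasible :: "nat \<Rightarrow> nat \<Rightarrow> job set \<Rightarrow> schedule \<Rightarrow> bool" where
  "feasible lam T J S \<longleftrightarrow>
     finite (cals S) \<and>
     (\<forall>m s s'. (m, s) \<in> cals S \<longrightarrow> (m, s') \<in> cals S \<longrightarrow> s \<noteq> s' \<longrightarrow>
        occupied lam T s \<inter> occupied lam T s' = {}) \<and>
     (\<forall>(j, m, t) \<in> runs S.
        j \<in> J \<and> release j \<le> t \<and> t + 1 \<le> deadline j \<and>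
        (\<exists>s. (m, s) \<in> cals S \<and> t \<in> calibrated lam T s)) \<and>
     (\<forall>j j' m t. (j, m, t) \<in> runs S \<longrightarrow> (j', m, t) \<in> runs S \<longrightarrow> j = j') \<and>
     (\<forall>j\<in>J. \<exists>!(m, t). (j, m, t) \<in> runs S)"

definition num_cals :: "schedule \<Rightarrow> nat" where
  "num_cals S = card (cals S)"

definition opt :: "nat \<Rightarrow> nat \<Rightarrow> job set \<Rightarrow> nat" where
  "opt lam T J = (LEAST n. \<exists>S. feasible lam T J S \<and> num_cals S = n)"

text \<open>
  A deterministic online algorithm maps the current time \<open>t\<close> and the set of jobs revealed so far
  to the set of machines on which a calibration is started at time \<open>t\<close> and the set of pairs
  \<open>(j, m)\<close> such that job \<open>j\<close> is processed on machine \<open>m\<close> during \<open>[t, t + 1)\<close>. The earlier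
  decisions of the algorithm are not passed as an argument because they are determined by the
  jobs revealed so far, whose release times are part of the job data.
\<close>

type_synonym online_alg = "int \<Rightarrow> job set \<Rightarrow> nat set \<times> (job \<times> nat) set"

definition revealed :: "job set \<Rightarrow> int \<Rightarrow> job set" where
  "revealed J t = {j \<in> J. release j \<le> t}"

definition execute :: "online_alg \<Rightarrow> job set \<Rightarrow> schedule" where
  "execute A J =
     \<lparr> cals = {(m, t). m \<in> fst (A t (revealed J t))},
       runs = {(j, m, t). (j, m) \<in> snd (A t (revealed J t))} \<rparr>"

definition solves_online :: "nat \<Rightarrow> nat \<Rightarrow> online_alg \<Rightarrow> bool" where
  "solves_online lam T A \<longleftrightarrow> (\<forall>J. valid_instance lam J \<longrightarrow> feasible lam T J (execute A J))"

definition competitive :: "nat \<Rightarrow> nat \<Rightarrow> real \<Rightarrow> online_alg \<Rightarrow> bool" where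
  "competitive lam T c A \<longleftrightarrow>
     (\<exists>a::real. \<forall>J. valid_instance lam J \<longrightarrow>
        real (num_cals (execute A J)) \<le> c * real (opt lam T J) + a)"

text \<open>For \<open>T \<ge> 1\<close> every instance has a feasible schedule, so \<open>opt\<close> is a genuine minimum.\<close>

lemma feasible_exists:
  assumes "valid_instance lam J" and "T \<ge> 1"
  shows "\<exists>S. feasible lam T J S"
proof -
  have fin: "finite J" and win: "\<And>j. j \<in> J \<Longrightarrow> deadline j - release j \<ge> 1 + int lam"
    using assms(1) by (auto simp: valid_instance_def)
  obtain f :: "job \<Rightarrow> nat" where f: "inj_on f J"
    using finite_imp_inj_to_nat_seg[OF fin] by blast
  define S where "S = \<lparr> cals = (\<lambda>j. (f j, release j)) ` J,
    runs = (\<lambda>j. (j, f j, release j + int lam)) ` J \<rparr>"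
  have "feasible lam T J S"
    unfolding feasible_def
  proof (intro conjI)
    show "\<forall>(j, m, t) \<in> runs S. j \<in> J \<and> release j \<le> t \<and> t + 1 \<le> deadline j \<and>
        (\<exists>s. (m, s) \<in> cals S \<and> t \<in> calibrated lam T s)"
      using assms(2) by (fastforce simp: S_def calibrated_def dest: win)
  qed (use fin f in \<open>auto simp: S_def inj_on_def\<close>)
  then show ?thesis ..
qed

lemma opt_attained:
  assumes "valid_instance lam J" and "T \<ge> 1"
  shows "\<exists>S. feasible lam T J S \<and> num_cals S = opt lam T J"
proof -
  have "\<exists>n S. feasible lam T J S \<and> num_cals S = n"
    using feasible_exists[OF assms] by blast
  then show ?thesis
    unfolding opt_def by (rule LeastI_ex)
qed

lemma opt_le: "feasible lam T J S \<Longrightarrow> opt lam T J \<le> num_cals S"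
  unfolding opt_def by (rule Least_le) blast

end

theory Submission
  imports Defs "HOL-Analysis.Henstock_Kurzweil_Integration" "HOL-Library.Countable"
begin

text \<open>
  Delaying every release time by \<open>lam\<close> makes a calibration usable from the moment it is decided
  on. Jobs are then split by the length of their window.

  Short jobs (window at most \<open>w = T div 2\<close>) are run by earliest deadline first on \<open>\<lceil>e \<rho>\<rceil>\<close>
  calibrations, where \<open>\<rho>\<close> is the largest density of known jobs over intervals of length at most
  \<open>2 w \<le> T\<close> around the current time. By the charging argument of Bansal, Kimbrel and Pruhs no
  deadline is missed. A block of \<open>T\<close> consecutive slots contains at most \<open>e \<rho> + 1\<close> starts, and each of
  the \<open>lam + 1\<close> shifted copies of an optimal calibration contributes at most \<open>3\<close> to the sum of the
  densities of the blocks; at most \<open>2 + lam\<close> blocks are charged to one optimal calibration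
  for the rounding.

  Long jobs (window at least \<open>h = w + 1\<close>) wait until \<open>h\<close> slots remain; calibrations are started
  only if the jobs that are then due do not fit into the active ones. A calibration either has at
  least \<open>h\<close> used slots, or it is paid for by idle time; all jobs that trigger a start after an
  idle slot were released after it, which bounds the idle time by \<open>(3 + lam) T\<close> per optimal calibration.
  Altogether the ratio is at most \<open>3 e (lam + 1) + 7 + 2 lam\<close>.
\<close>

section \<open>Separated sets and interval densities\<close>

definition separated :: "nat \<Rightarrow> int set \<Rightarrow> bool" where
  "separated T A \<longleftrightarrow> (\<forall>x\<in>A. \<forall>y\<in>A. x < y \<longrightarrow> x + int T \<le> y)"

text \<open>Each of the \<open>n\<close> consecutive blocks of length \<open>T\<close> starting at
  \<open>a\<close> holds at most one element, so the block number \<open>(x - a) div int T\<close>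
  is injective on \<open>A\<close>.\<close>

lemma separated_card_le:
  assumes "separated T A" "T \<ge> 1" "A \<subseteq> {a..<a + int n * int T}"
  shows "card A \<le> n"
proof -
  have "inj_on (\<lambda>x. (x - a) div int T) A"
  proof (rule linorder_inj_onI')
    fix x y assume "x \<in> A" "y \<in> A" "x < y"
    then have "(x - a) + int T \<le> y - a"
      using assms(1) by (auto simp: separated_def)
    then have "((x - a) + int T) div int T \<le> (y - a) div int T"
      using assms(2) by (intro zdiv_mono1) auto
    then show "(x - a) div int T \<noteq> (y - a) div int T"
      using assms(2) by simp
  qed
  moreover have "(\<lambda>x. (x - a) div int T) ` A \<subseteq> {0..<int n}"
  proof
    fix z assume "z \<in> (\<lambda>x. (x - a) div int T) ` A"
    then obtain x where x: "x \<in> A" "z = (x - a) div int T" by auto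
    then have "0 \<le> x - a" "x - a < int n * int T" using assms(3) by force+
    then have "0 \<le> z" using assms(2) by (simp add: x(2) pos_imp_zdiv_nonneg_iff)
    moreover have "z * int T \<le> x - a"
      using assms(2) minus_mod_eq_div_mult[of "x - a" "int T"] pos_mod_sign[of "int T" "x - a"]
      unfolding x(2) by linarith
    then have "z * int T < int n * int T" using \<open>x - a < int n * int T\<close> by linarith
    ultimately have "0 \<le> z" "z < int n"
      using mult_less_cancel_right_pos[of "int T" z "int n"] assms(2) by auto
    then show "z \<in> {0..<int n}" by simp
  qed
  ultimately have "card A \<le> card {0..<int n}"
    by (meson card_inj_on_le finite_atLeastLessThan_int)
  then show ?thesis by simp
qed

text \<open>Greedy choice: keep the minimum, discard everything less than \<open>T\<close> above it,
  and recurse on the rest.\<close>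

lemma separated_cover_exists:
  assumes "finite A" "T \<ge> 1"
  shows "\<exists>B\<subseteq>A. separated T B \<and> (\<forall>t\<in>A. \<exists>b\<in>B. b \<le> t \<and> t < b + int T)"
  using assms(1)
proof (induction "card A" arbitrary: A rule: less_induct)
  case less
  show ?case
  proof (cases "A = {}")
    case True
    then show ?thesis by (auto simp: separated_def)
  next
    case False
    define m where "m = Min A"
    have m: "m \<in> A" "\<And>t. t \<in> A \<Longrightarrow> m \<le> t"
      using False less.prems by (auto simp: m_def)
    define A' where "A' = {t\<in>A. m + int T \<le> t}"
    have "A' \<subset> A" using m assms(2) by (force simp: A'_def)
    then obtain B where B: "B \<subseteq> A'" "separated T B"
        "\<forall>t\<in>A'. \<exists>b\<in>B. b \<le> t \<and> t < b + int T"
      using less.hyps[of A'] less.prems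
      by (metis psubset_card_mono finite_subset psubset_imp_subset)
    have "separated T (insert m B)"
      using B(1,2) assms(2) unfolding separated_def A'_def by force
    moreover have "\<forall>t\<in>A. \<exists>b\<in>insert m B. b \<le> t \<and> t < b + int T"
      using B(3) m(2) by (force simp: A'_def)
    moreover have "insert m B \<subseteq> A" using B(1) m(1) by (auto simp: A'_def)
    ultimately show ?thesis by blast
  qed
qed

text \<open>With \<open>L = D - x\<close>, a calibration that meets [x, D) and sticks out of the
  large window by some number of slots on one side misses at least as many slots of [x, D) on the
  other side. Hence \<open>T - q \<le> L - p\<close>, and \<open>L \<le> T\<close> turns this into
  the inequality of fractions.\<close>

lemma overlap_fraction_le:
  fixes c x D \<tau> :: int
  assumes "x \<le> \<tau>" "\<tau> < D" "D - x \<le> int T"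
  shows "real (card ({c..<c + int T} \<inter> {x..<D})) / real_of_int (D - x)
    \<le> real (card ({c..<c + int T} \<inter> {\<tau> - int T..<\<tau> + int T})) / real T"
proof -
  define L where "L = D - x"
  have L: "1 \<le> L" "L \<le> int T" using assms by (auto simp: L_def)
  define p where "p = int (card ({c..<c + int T} \<inter> {x..<D}))"
  define q where "q = int (card ({c..<c + int T} \<inter> {\<tau> - int T..<\<tau> + int T}))"
  have p: "p = max 0 (min (c + int T) D - max c x)"
    by (auto simp: p_def max_def min_def)
  have q: "q = max 0 (min (c + int T) (\<tau> + int T) - max c (\<tau> - int T))"
    by (auto simp: q_def max_def min_def)
  have "p * int T \<le> q * L"
  proof (cases "p = 0")
    case True
    then show ?thesis using L by (simp add: q_def)
  next
    case False
    have pL: "p \<le> L" using assms unfolding p L_def by linarith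
    have *: "L - p \<ge> int T - q"
      using False assms unfolding p q L_def by linarith
    have "(L - p) * int T \<ge> (int T - q) * L"
    proof (cases "int T \<ge> q")
      case True
      then have "(int T - q) * L \<le> (L - p) * L" using * L by (intro mult_right_mono) auto
      also have "\<dots> \<le> (L - p) * int T" using pL L by (intro mult_left_mono) auto
      finally show ?thesis .
    next
      case False
      then have "(int T - q) * L \<le> 0" using L by (simp add: mult_nonpos_nonneg)
      also have "0 \<le> (L - p) * int T" using pL by simp
      finally show ?thesis .
    qed
    then show ?thesis by (simp add: algebra_simps)
  qed
  then have "real_of_int p * real T \<le> real_of_int q * real_of_int L"
    by (metis of_int_le_iff of_int_mult of_int_of_nat_eq)
  then have "real_of_int p / real_of_int L \<le> real_of_int q / real T"
    using L by (simp add: divide_simps mult.commute)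
  then show ?thesis
    unfolding p_def q_def L_def of_int_of_nat_eq .
qed

section \<open>Logarithmic charging of work to remaining time\<close>

lemma integral_unit_intervals:
  fixes f :: "real \<Rightarrow> real"
  assumes "f integrable_on {0..real n}"
  shows "integral {0..real n} f = (\<Sum>m=1..n. integral {real m - 1..real m} f)"
  using assms
proof (induction n)
  case (Suc n)
  have "f integrable_on {0..real n}"
    using Suc.prems by (rule integrable_on_subinterval) auto
  with Suc.IH have "integral {0..real n} f = (\<Sum>m=1..n. integral {real m - 1..real m} f)" .
  moreover have "integral {0..real n} f + integral {real n..real (Suc n)} f
      = integral {0..real (Suc n)} f"
    using Suc.prems by (intro Henstock_Kurzweil_Integration.integral_combine) auto
  ultimately show ?case by simp
qed simp

lemma has_integral_inverse:
  fixes a b :: real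
  assumes "0 < a" "a \<le> b"
  shows "((\<lambda>y. 1 / y) has_integral (ln b - ln a)) {a..b}"
proof (rule fundamental_theorem_of_calculus)
  fix x assume "x \<in> {a..b}"
  then show "(ln has_vector_derivative 1 / x) (at x within {a..b})"
    using assms(1) unfolding has_real_derivative_iff_has_vector_derivative[symmetric]
    by (auto intro!: derivative_eq_intros)
qed (fact assms(2))

text \<open>Only the lower end \<open>u / e\<close> of the range of \<open>y\<close> is built in;
  the upper end \<open>u\<close> comes from the domains of integration.\<close>

definition kern :: "nat \<Rightarrow> real \<Rightarrow> real" where
  "kern u y = (if real u \<le> exp 1 * y then 1 / y else 0)"

text \<open>The constant e enters here: \<open>ln u - ln (u / exp 1) = 1\<close>, so every job
  spreads exactly one unit.\<close>

lemma kern_has_integral: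
  assumes "u \<ge> 1"
  shows "(kern u has_integral 1) {0..real u}"
proof -
  have e: "exp (1::real) \<ge> 1" by simp
  have le: "real u / exp 1 \<le> real u"
    using e assms by (simp add: divide_le_eq mult_left_le)
  have "((\<lambda>y. 1 / y) has_integral (ln (real u) - ln (real u / exp 1))) {real u / exp 1..real u}"
    using assms le by (intro has_integral_inverse) auto
  moreover have "ln (real u) - ln (real u / exp 1) = 1"
    using assms by (simp add: ln_div)
  ultimately have "((\<lambda>y. 1 / y) has_integral 1) (cbox (real u / exp 1) (real u))"
    by simp
  then have "((\<lambda>y. if y \<in> cbox (real u / exp 1) (real u) then 1 / y else 0)
      has_integral 1) (cbox 0 (real u))"
    by (subst has_integral_restrict) auto
  moreover have "(if y \<in> cbox (real u / exp 1) (real u) then 1 / y else 0) = kern u y"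
    if "y \<in> cbox 0 (real u)" for y
    using that by (auto simp: kern_def field_simps)
  ultimately have "(kern u has_integral 1) (cbox 0 (real u))"
    by (rule has_integral_eq[rotated])
  then show ?thesis by simp
qed

lemma kern_integrable:
  assumes "u \<ge> 1" "1 \<le> m" "m \<le> u"
  shows "kern u integrable_on {real m - 1..real m}"
  by (rule integrable_on_subinterval[OF has_integral_integrable[OF kern_has_integral[OF assms(1)]]])
    (use assms in auto)

text \<open>
  Charging argument of Bansal, Kimbrel and Pruhs. A job released \<open>u\<close> slots before the deadline
  under consideration distributes one unit of work, with density \<open>1 / y\<close>, over the part of the
  time axis where the remaining time \<open>y\<close> is between \<open>u / e\<close> and \<open>u\<close>. Jobs with \<open>u > 2 w\<close>
  spread it evenly over the \<open>w\<close> slots after their release, so that only intervals of length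
  at most \<open>2 w\<close> are needed.
\<close>

lemma card_le_sum_density:
  fixes u :: "'a \<Rightarrow> nat" and \<rho> :: "nat \<Rightarrow> real"
  assumes fin: "finite N" and w: "w \<ge> 1"
    and u: "\<And>j. j \<in> N \<Longrightarrow> 1 \<le> u j \<and> u j \<le> M"
    and rho: "\<And>m. 0 \<le> \<rho> m"
    and near: "\<And>m L. 1 \<le> m \<Longrightarrow> m \<le> L \<Longrightarrow> L \<le> 2 * w \<Longrightarrow>
      real (card {j\<in>N. m \<le> u j \<and> u j \<le> L}) \<le> \<rho> m * real L"
    and far: "\<And>m. w < m \<Longrightarrow> real (card {j\<in>N. m \<le> u j \<and> u j \<le> m + w}) \<le> \<rho> m * real (2 * w)"
  shows "real (card N) \<le> (\<Sum>m=1..M. exp 1 * \<rho> m)"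
proof -
  have e2: "exp (1::real) \<ge> 2" using exp_ge_add_one_self[of 1] by simp
  \<comment> \<open>The share of job \<open>j\<close> in the \<open>m\<close>-th slot before the
    deadline, where the remaining time runs through [m - 1, m].\<close>
  define W where "W j m = (if u j \<le> 2 * w
      then (if m \<le> u j then integral {real m - 1..real m} (kern (u j)) else 0)
      else (if m \<le> u j \<and> u j < m + w then 1 / real w else 0))" for j m
  have total: "(\<Sum>m=1..M. W j m) = 1" if "j \<in> N" for j
  proof (cases "u j \<le> 2 * w")
    case True
    have "(\<Sum>m=1..M. W j m) = (\<Sum>m=1..u j. integral {real m - 1..real m} (kern (u j)))"
      using u[OF that] True
      by (intro sum.mono_neutral_cong_right) (auto simp: W_def)
    also have "\<dots> = integral {0..real (u j)} (kern (u j))"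
      using kern_has_integral[of "u j"] u[OF that]
      by (intro integral_unit_intervals[symmetric]) (auto simp: integrable_on_def)
    also have "\<dots> = 1"
      using kern_has_integral[of "u j"] u[OF that] by (intro integral_unique) auto
    finally show ?thesis .
  next
    case False
    have "(\<Sum>m=1..M. W j m) = (\<Sum>m\<in>{u j - w<..u j}. 1 / real w)"
      using u[OF that] False
      by (intro sum.mono_neutral_cong_right) (auto simp: W_def)
    also have "\<dots> = 1" using w False by simp
    finally show ?thesis .
  qed
  have slot: "(\<Sum>j\<in>N. W j m) \<le> exp 1 * \<rho> m" if m: "1 \<le> m" for m
  proof (cases "m \<le> w")
    case True
    define N' where "N' = {j\<in>N. m \<le> u j \<and> u j \<le> 2 * w}"
    have finN': "finite N'" using fin by (simp add: N'_def)
    have int: "\<And>j. j \<in> N' \<Longrightarrow> kern (u j) integrable_on {real m - 1..real m}"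
      using m by (intro kern_integrable) (auto simp: N'_def)
    have "(\<Sum>j\<in>N. W j m) = (\<Sum>j\<in>N'. integral {real m - 1..real m} (kern (u j)))"
      using fin True by (intro sum.mono_neutral_cong_right) (auto simp: W_def N'_def)
    also have "\<dots> = integral {real m - 1..real m} (\<lambda>y. \<Sum>j\<in>N'. kern (u j) y)"
      using finN' int by (intro integral_sum[symmetric]) auto
    also have "\<dots> \<le> integral {real m - 1..real m} (\<lambda>y. exp 1 * \<rho> m)"
    proof (rule integral_le)
      show "(\<lambda>y. \<Sum>j\<in>N'. kern (u j) y) integrable_on {real m - 1..real m}"
        using finN' int by (intro integrable_sum) auto
      fix y assume y: "y \<in> {real m - 1..real m}"
      \<comment> \<open>The kernel of \<open>j\<close> is nonzero at \<open>y\<close> only if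
        \<open>u j \<le> exp 1 * y\<close>. The cap \<open>2 * w\<close> makes \<open>near\<close>
        applicable, and \<open>L \<le> exp 1 * y\<close> cancels the factor
        \<open>1 / y\<close>.\<close>
      define L where "L = min (nat \<lfloor>exp 1 * y\<rfloor>) (2 * w)"
      have y0: "y \<ge> 0" using y m by auto
      have "(\<Sum>j\<in>N'. kern (u j) y) = (\<Sum>j\<in>{j\<in>N. m \<le> u j \<and> u j \<le> L}. 1 / y)"
      proof (intro sum.mono_neutral_cong_right)
        show "{j \<in> N. m \<le> u j \<and> u j \<le> L} \<subseteq> N'" by (auto simp: N'_def L_def)
        show "\<forall>i\<in>N' - {j \<in> N. m \<le> u j \<and> u j \<le> L}. kern (u i) y = 0"
          by (auto simp: N'_def L_def kern_def le_nat_floor)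
        fix j assume "j \<in> {j \<in> N. m \<le> u j \<and> u j \<le> L}"
        then have "real (u j) \<le> real (nat \<lfloor>exp 1 * y\<rfloor>)" by (simp add: L_def)
        also have "\<dots> \<le> exp 1 * y" using y0 by simp
        finally show "kern (u j) y = 1 / y" by (simp add: kern_def)
      qed (fact finN')
      also have "\<dots> = real (card {j\<in>N. m \<le> u j \<and> u j \<le> L}) / y" by simp
      also have "\<dots> \<le> exp 1 * \<rho> m"
      proof (cases "m \<le> L \<and> y > 0")
        case True
        have "real (card {j\<in>N. m \<le> u j \<and> u j \<le> L}) \<le> \<rho> m * real L"
          using near[of m L] m True by (auto simp: L_def)
        also have "\<dots> \<le> \<rho> m * (exp 1 * y)"
        proof (intro mult_left_mono rho)
          have "real L \<le> real (nat \<lfloor>exp 1 * y\<rfloor>)" by (simp add: L_def)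
          also have "\<dots> \<le> exp 1 * y" using y0 by simp
          finally show "real L \<le> exp 1 * y" .
        qed
        finally show ?thesis using True by (simp add: field_simps)
      next
        case False
        \<comment> \<open>For \<open>y = 0\<close> the quotient is 0 by the convention on division;
          otherwise \<open>L < m\<close> and no job is counted.\<close>
        then have "y = 0 \<or> {j\<in>N. m \<le> u j \<and> u j \<le> L} = {}" using y0 by auto
        then show ?thesis
          using rho[of m] by (elim disjE) (simp_all del: Collect_empty_eq)
      qed
      finally show "(\<Sum>j\<in>N'. kern (u j) y) \<le> exp 1 * \<rho> m" .
    qed (simp add: integrable_const_ivl)
    also have "\<dots> = exp 1 * \<rho> m" by simp
    finally show ?thesis .
  next
    case False
    \<comment> \<open>Now \<open>y \<ge> m - 1 \<ge> w\<close>, so both ways of spreading put at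
      most \<open>1 / w\<close> into the slot.\<close>
    have Wle: "W j m \<le> 1 / real w" if j: "j \<in> N" "m \<le> u j" for j
    proof (cases "u j \<le> 2 * w")
      case True
      have "integral {real m - 1..real m} (kern (u j))
          \<le> integral {real m - 1..real m} (\<lambda>y. 1 / real w)"
      proof (rule integral_le)
        fix y assume "y \<in> {real m - 1..real m}"
        then have "real w \<le> y" using False by auto
        then have "1 / y \<le> 1 / real w" using w by (intro divide_left_mono) auto
        then show "kern (u j) y \<le> 1 / real w" by (simp add: kern_def)
      qed (use m j in \<open>auto intro!: kern_integrable integrable_const_ivl\<close>)
      then show ?thesis using True j by (simp add: W_def)
    qed (simp add: W_def)
    \<comment> \<open>Jobs with \<open>u j \<le> 2 * w\<close> satisfy
      \<open>u j \<le> m + w\<close> because \<open>m > w\<close>, so \<open>far\<close> counts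
      every contributing job. Its factor 2 is absorbed by \<open>exp 1 \<ge> 2\<close>.\<close>
    have "(\<Sum>j\<in>N. W j m) = (\<Sum>j\<in>{j\<in>N. m \<le> u j \<and> u j \<le> m + w}. W j m)"
      using fin False by (intro sum.mono_neutral_right) (auto simp: W_def)
    also have "\<dots> \<le> (\<Sum>j\<in>{j\<in>N. m \<le> u j \<and> u j \<le> m + w}. 1 / real w)"
      using Wle by (intro sum_mono) auto
    also have "\<dots> = real (card {j\<in>N. m \<le> u j \<and> u j \<le> m + w}) / real w" by simp
    also have "\<dots> \<le> (\<rho> m * real (2 * w)) / real w"
      using far[of m] False by (intro divide_right_mono) auto
    also have "\<dots> = 2 * \<rho> m" using w by simp
    also have "\<dots> \<le> exp 1 * \<rho> m" using e2 rho by (intro mult_right_mono) auto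
    finally show ?thesis .
  qed
  have "real (card N) = (\<Sum>j\<in>N. \<Sum>m=1..M. W j m)" using total by simp
  also have "\<dots> = (\<Sum>m=1..M. \<Sum>j\<in>N. W j m)" by (rule sum.swap)
  also have "\<dots> \<le> (\<Sum>m=1..M. exp 1 * \<rho> m)" using slot by (intro sum_mono) auto
  finally show ?thesis .
qed

section \<open>Earliest deadline first\<close>

text \<open>\<open>s u\<close> counts the calibrations whose first usable slot is \<open>u\<close>;
  those usable at \<open>t\<close> have their first slot among the last \<open>T\<close>
  ones.\<close>

definition active :: "nat \<Rightarrow> (int \<Rightarrow> nat) \<Rightarrow> int \<Rightarrow> nat" where
  "active T s t = (\<Sum>u\<in>{t - int T<..t}. s u)"

text \<open>What is known just before the decision at \<open>t\<close>. Evaluating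
  \<open>active T (hist s t) v\<close> at a later \<open>v\<close> tells how many of these
  calibrations are still usable then.\<close>

definition hist :: "(int \<Rightarrow> nat) \<Rightarrow> int \<Rightarrow> int \<Rightarrow> nat" where
  "hist s t = (\<lambda>u. if u < t then s u else 0)"

definition pending :: "('a \<Rightarrow> int) \<Rightarrow> 'a set \<Rightarrow> 'a set \<Rightarrow> int \<Rightarrow> 'a set" where
  "pending r J C t = {j\<in>J. r j \<le> t} - C"

lemma active_hist_Suc:
  assumes "t \<le> v"
  shows "active T (hist s (t + 1)) v = active T (hist s t) v + (if v < t + int T then s t else 0)"
proof -
  have "active T (hist s (t + 1)) v
      = (\<Sum>u\<in>{v - int T<..v}. hist s t u + (if u = t then s t else 0))"
    unfolding active_def by (rule sum.cong) (auto simp: hist_def)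
  also have "\<dots> = active T (hist s t) v + (\<Sum>u\<in>{v - int T<..v}. if u = t then s t else 0)"
    by (simp add: active_def sum.distrib)
  also have "(\<Sum>u\<in>{v - int T<..v}. if u = t then s t else 0) = (if v < t + int T then s t else 0)"
    using assms by (simp add: algebra_simps)
  finally show ?thesis .
qed

lemma active_hist_self: "active T (hist s (t + 1)) t = active T s t"
  unfolding active_def by (rule sum.cong) (auto simp: hist_def)

lemma active_split:
  assumes "T \<ge> 1"
  shows "active T s t = active T (hist s t) t + s t"
  using active_hist_Suc[of t t T s] assms by (simp add: active_hist_self)

text \<open>Time has no least element, so the induction starts at a moment that precedes
  \<open>t\<close> and all releases.\<close>

lemma time_induct:
  fixes r :: "'a \<Rightarrow> int"
  assumes "finite J"
    and base: "\<And>t. (\<And>j. j \<in> J \<Longrightarrow> t \<le> r j) \<Longrightarrow> P t"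
    and step: "\<And>t. P t \<Longrightarrow> P (t + 1)"
  shows "P t"
proof -
  define B where "B = Min (insert t (r ` J))"
  have B: "B \<le> t" "\<And>j. j \<in> J \<Longrightarrow> B \<le> r j"
    using assms(1) by (auto simp: B_def)
  show ?thesis
    by (rule int_ge_induct[OF B(1)]) (auto intro: base B(2) step)
qed

text \<open>A run with an arbitrary start function \<open>s\<close>, shared by both job classes:
  \<open>served t\<close> holds the jobs processed before \<open>t\<close>, \<open>X t\<close> those
  processed in slot \<open>t\<close>. Meeting deadlines is left to the start rules.\<close>

locale edf_run =
  fixes J :: "'a set" and r d :: "'a \<Rightarrow> int" and T :: nat and s :: "int \<Rightarrow> nat"
    and served X :: "int \<Rightarrow> 'a set"
  assumes fin: "finite J" and T: "T \<ge> 1" and window: "j \<in> J \<Longrightarrow> r j < d j"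
    and served_init: "(\<And>j. j \<in> J \<Longrightarrow> t \<le> r j) \<Longrightarrow> served t = {}"
    and served_Suc: "served (t + 1) = served t \<union> X t"
    and X_subset: "X t \<subseteq> pending r J (served t) t"
    and X_card: "card (X t) = min (active T s t) (card (pending r J (served t) t))"
    and X_edf: "x \<in> X t \<Longrightarrow> y \<in> pending r J (served t) t - X t \<Longrightarrow> d x \<le> d y"
begin

abbreviation P :: "int \<Rightarrow> 'a set" where
  "P t \<equiv> pending r J (served t) t"

lemma finite_P: "finite (P t)"
  using fin by (simp add: pending_def)

lemma finite_X: "finite (X t)"
  using X_subset finite_P by (rule finite_subset)

lemma served_subset: "served t \<subseteq> {j\<in>J. r j < t}"
proof (rule time_induct[OF fin, where r = r and t = t])
  fix t assume "served t \<subseteq> {j\<in>J. r j < t}"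
  then show "served (t + 1) \<subseteq> {j\<in>J. r j < t + 1}"
    using X_subset[of t] by (force simp: served_Suc pending_def)
qed (use served_init in auto)

lemma finite_served: "finite (served t)"
  using served_subset[of t] fin by (auto intro: finite_subset)

lemma served_mono: "t \<le> t' \<Longrightarrow> served t \<subseteq> served t'"
  by (induction t' rule: int_ge_induct) (auto simp: served_Suc)

lemma served_eq: "served t = (\<Union>v\<in>{..<t}. X v)"
proof (rule time_induct[OF fin, where r = r and t = t])
  fix t assume *: "\<And>j. j \<in> J \<Longrightarrow> t \<le> r j"
  then show "served t = (\<Union>v\<in>{..<t}. X v)"
    using X_subset by (force simp: served_init pending_def)
next
  fix t assume *: "served t = (\<Union>v\<in>{..<t}. X v)"
  have "{..<t + 1} = insert t {..<t}" by auto
  then show "served (t + 1) = (\<Union>v\<in>{..<t + 1}. X v)"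
    by (simp only: served_Suc *) auto
qed

lemma card_served:
  "p \<le> q \<Longrightarrow> card (served q) = card (served p) + (\<Sum>v\<in>{p..<q}. card (X v))"
proof (induction q rule: int_ge_induct)
  case (step q)
  have "card (served (q + 1)) = card (served q) + card (X q)"
    unfolding served_Suc using X_subset[of q] finite_served finite_X
    by (intro card_Un_disjoint) (auto simp: pending_def)
  moreover have "{p..<q + 1} = insert q {p..<q}" using step.hyps by auto
  ultimately show ?case using step.IH by simp
qed simp

text \<open>If a job with deadline at most \<open>D\<close> has to wait, earliest deadline first
  spends all active calibrations on jobs with deadline at most \<open>D\<close>.\<close>

lemma edf_slot:
  "{j\<in>P t. d j \<le> D} \<subseteq> X t \<or>
   (card ({j\<in>P t. d j \<le> D} - X t) + active T s t = card {j\<in>P t. d j \<le> D}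
     \<and> active T s t < card (P t))"
proof (intro disj_imp[THEN iffD2] impI)
  assume "\<not> {j\<in>P t. d j \<le> D} \<subseteq> X t"
  then obtain y where y: "y \<in> P t" "d y \<le> D" "y \<notin> X t" by auto
  then have sub: "X t \<subseteq> {j\<in>P t. d j \<le> D}"
    using X_edf[of _ t y] X_subset[of t] by force
  have "X t \<subset> P t" using y X_subset by auto
  then have "card (X t) < card (P t)" using finite_P by (simp add: psubset_card_mono)
  then have a: "card (X t) = active T s t" "active T s t < card (P t)" using X_card[of t] by auto
  have "card ({j\<in>P t. d j \<le> D} - X t) = card {j\<in>P t. d j \<le> D} - card (X t)"
    using sub finite_X by (simp add: card_Diff_subset)
  moreover have "card (X t) \<le> card {j\<in>P t. d j \<le> D}"
    using sub finite_P by (intro card_mono) auto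
  ultimately show "card ({j\<in>P t. d j \<le> D} - X t) + active T s t = card {j\<in>P t. d j \<le> D}
     \<and> active T s t < card (P t)"
    using a by simp
qed

lemma idle_P_served:
  assumes "card (X t) < active T s t"
  shows "{j\<in>J. r j \<le> t} \<subseteq> served (t + 1)"
proof -
  have "card (X t) = card (P t)" using assms X_card[of t] by simp
  then have "X t = P t" using X_subset finite_P by (metis card_subset_eq)
  then show ?thesis by (auto simp: served_Suc pending_def)
qed

end

locale timely_edf_run = edf_run +
  assumes timely: "{j\<in>J. d j \<le> D} \<subseteq> served D"
begin

lemma P_alive: "j \<in> P t \<Longrightarrow> j \<in> J \<and> r j \<le> t \<and> t < d j"
proof -
  assume j: "j \<in> P t"
  then have "t < d j"
    using timely[of "d j"] served_mono[of "d j" t] by (force simp: pending_def)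
  with j show ?thesis by (auto simp: pending_def)
qed

lemma X_alive: "j \<in> X t \<Longrightarrow> j \<in> J \<and> r j \<le> t \<and> t < d j"
  using X_subset P_alive by blast

lemma X_unique: "j \<in> X t \<Longrightarrow> j \<in> X t' \<Longrightarrow> t = t'"
proof (induction t t' rule: linorder_wlog)
  case (le t t')
  show ?case
  proof (rule ccontr)
    assume "t \<noteq> t'"
    then have "j \<in> served t'" using le by (auto simp: served_eq)
    then show False using le X_subset[of t'] by (auto simp: pending_def)
  qed
qed auto

lemma X_exists: "j \<in> J \<Longrightarrow> \<exists>t. j \<in> X t"
  using timely[of "d j"] by (auto simp: served_eq)

lemma finite_nonempty_P: "finite {t. P t \<noteq> {}}"
proof (rule finite_subset)
  show "{t. P t \<noteq> {}} \<subseteq> (\<Union>j\<in>J. {r j..d j})"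
    using P_alive by force
qed (use fin in auto)

end

section \<open>Jobs with short windows\<close>

text \<open>The inserted 0 keeps the maximum defined when \<open>w = 0\<close>, where no interval
  qualifies.\<close>

definition density :: "('a \<Rightarrow> int) \<Rightarrow> ('a \<Rightarrow> int) \<Rightarrow> nat \<Rightarrow> 'a set \<Rightarrow> int \<Rightarrow> real" where
  "density r d w R t = Max (insert 0
     ((\<lambda>(x, D). real (card {j\<in>R. x \<le> r j \<and> d j \<le> D}) / real_of_int (D - x)) `
       {(x, D). x \<le> t \<and> t < D \<and> D - x \<le> 2 * int w}))"

lemma finite_density_intervals: "finite {(x, D). x \<le> t \<and> t < D \<and> D - x \<le> 2 * int w}"
  by (rule finite_subset[of _ "{t - 2 * int w..t} \<times> {t..t + 2 * int w}"]) auto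

lemma density_nonneg: "density r d w R t \<ge> 0"
  unfolding density_def using finite_density_intervals by (intro Max_ge) auto

lemma density_ge:
  assumes "x \<le> t" "t < D" "D - x \<le> 2 * int w"
  shows "real (card {j\<in>R. x \<le> r j \<and> d j \<le> D}) \<le> density r d w R t * real_of_int (D - x)"
proof -
  have "real (card {j\<in>R. x \<le> r j \<and> d j \<le> D}) / real_of_int (D - x) \<le> density r d w R t"
    unfolding density_def using finite_density_intervals assms
    by (intro Max_ge) (auto intro!: image_eqI[where x = "(x, D)"])
  then show ?thesis using assms by (simp add: divide_simps split: if_splits)
qed

lemma density_cases:
  obtains "density r d w R t = 0"
  | x D where "x \<le> t" "t < D" "D - x \<le> 2 * int w"
      "density r d w R t = real (card {j\<in>R. x \<le> r j \<and> d j \<le> D}) / real_of_int (D - x)"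
proof -
  have "density r d w R t \<in> insert 0
     ((\<lambda>(x, D). real (card {j\<in>R. x \<le> r j \<and> d j \<le> D}) / real_of_int (D - x)) `
       {(x, D). x \<le> t \<and> t < D \<and> D - x \<le> 2 * int w})"
    unfolding density_def using finite_density_intervals by (intro Max_in) auto
  then show ?thesis using that by auto
qed

locale short_run = edf_run +
  fixes w :: nat
  assumes w: "2 * w \<le> T"
    and short: "j \<in> J \<Longrightarrow> d j \<le> r j + int w"
    and start: "s t = min (nat \<lceil>exp 1 * density r d w {j\<in>J. r j \<le> t} t\<rceil>) (card (P t))
      - active T (hist s t) t"
begin

abbreviation dens :: "int \<Rightarrow> real" where
  "dens t \<equiv> density r d w {j\<in>J. r j \<le> t} t"

abbreviation demand :: "int \<Rightarrow> nat" where
  "demand t \<equiv> nat \<lceil>exp 1 * dens t\<rceil>"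

lemma active_ge: "min (demand t) (card (P t)) \<le> active T s t"
  using active_split[OF T, of s t] start[of t] by linarith

text \<open>\<open>x\<close> follows the last slot in which all pending jobs with deadline at most
  \<open>D\<close> were run. In every slot since then at least \<open>demand v\<close> such jobs
  were processed, and all of them were released at \<open>x\<close> or later.\<close>

lemma backlog:
  "\<exists>x\<le>t. card ({j\<in>J. r j < t \<and> d j \<le> D} - served t) + (\<Sum>v\<in>{x..<t}. demand v)
     \<le> card {j\<in>J. x \<le> r j \<and> r j < t \<and> d j \<le> D}"
proof (rule time_induct[OF fin, where r = r and t = t])
  fix t assume "\<And>j. j \<in> J \<Longrightarrow> t \<le> r j"
  then have "{j\<in>J. r j < t \<and> d j \<le> D} = {}" by force
  then show "\<exists>x\<le>t. card ({j\<in>J. r j < t \<and> d j \<le> D} - served t) + (\<Sum>v\<in>{x..<t}. demand v)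
     \<le> card {j\<in>J. x \<le> r j \<and> r j < t \<and> d j \<le> D}"
    by (intro exI[of _ t]) (simp del: Collect_empty_eq)
next
  fix t
  assume "\<exists>x\<le>t. card ({j\<in>J. r j < t \<and> d j \<le> D} - served t) + (\<Sum>v\<in>{x..<t}. demand v)
     \<le> card {j\<in>J. x \<le> r j \<and> r j < t \<and> d j \<le> D}"
  then obtain x where x: "x \<le> t"
    "card ({j\<in>J. r j < t \<and> d j \<le> D} - served t) + (\<Sum>v\<in>{x..<t}. demand v)
     \<le> card {j\<in>J. x \<le> r j \<and> r j < t \<and> d j \<le> D}" by auto
  let ?E = "{j\<in>P t. d j \<le> D}" and ?new = "{j\<in>J. r j = t \<and> d j \<le> D}"
  have Q: "{j\<in>J. r j < t + 1 \<and> d j \<le> D} - served (t + 1) = ?E - X t"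
    by (auto simp: served_Suc pending_def)
  from edf_slot[of t D]
  show "\<exists>x\<le>t + 1. card ({j\<in>J. r j < t + 1 \<and> d j \<le> D} - served (t + 1))
       + (\<Sum>v\<in>{x..<t + 1}. demand v)
     \<le> card {j\<in>J. x \<le> r j \<and> r j < t + 1 \<and> d j \<le> D}"
  proof
    assume "?E \<subseteq> X t"
    then have "card (?E - X t) = 0" by (metis Diff_eq_empty_iff card.empty)
    \<comment> \<open>The backlog is empty after slot \<open>t\<close>, so counting restarts at
      \<open>t + 1\<close>.\<close>
    then show ?thesis unfolding Q by (intro exI[of _ "t + 1"]) simp
  next
    assume E: "card (?E - X t) + active T s t = card ?E \<and> active T s t < card (P t)"
    then have a: "demand t \<le> active T s t" using active_ge[of t] by linarith
    have "?E \<subseteq> ({j\<in>J. r j < t \<and> d j \<le> D} - served t) \<union> ?new"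
      by (auto simp: pending_def)
    then have "card ?E \<le> card (({j\<in>J. r j < t \<and> d j \<le> D} - served t) \<union> ?new)"
      using fin by (intro card_mono) auto
    also have "\<dots> \<le> card ({j\<in>J. r j < t \<and> d j \<le> D} - served t) + card ?new"
      by (rule card_Un_le)
    finally have "card ?E \<le> card ({j\<in>J. r j < t \<and> d j \<le> D} - served t) + card ?new" .
    moreover have "card {j\<in>J. x \<le> r j \<and> r j < t + 1 \<and> d j \<le> D}
        = card {j\<in>J. x \<le> r j \<and> r j < t \<and> d j \<le> D} + card ?new"
      using fin x(1) by (subst card_Un_disjoint[symmetric]) (auto intro!: arg_cong[where f = card])
    moreover have "{x..<t + 1} = insert t {x..<t}" using x(1) by auto
    then have "(\<Sum>v\<in>{x..<t + 1}. demand v) = demand t + (\<Sum>v\<in>{x..<t}. demand v)" by simp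
    ultimately have "card (?E - X t) + (\<Sum>v\<in>{x..<t + 1}. demand v)
        \<le> card {j\<in>J. x \<le> r j \<and> r j < t + 1 \<and> d j \<le> D}"
      using x(2) E a by linarith
    then show ?thesis unfolding Q using x(1) by (intro exI[of _ x]) simp
  qed
qed

text \<open>The charging argument with \<open>u j = D - r j\<close>: the \<open>m\<close>-th slot
  before \<open>D\<close> is the time \<open>D - m\<close>, and the density there counts only jobs
  released by then.\<close>

lemma card_le_demand:
  assumes "x \<le> D"
  shows "card {j\<in>J. x \<le> r j \<and> r j < D \<and> d j \<le> D} \<le> (\<Sum>v\<in>{x..<D}. demand v)"
proof (cases "w = 0")
  case True
  then have "J = {}" using short window by force
  then show ?thesis by simp
next
  case False
  define N where "N = {j\<in>J. x \<le> r j \<and> r j < D \<and> d j \<le> D}"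
  define u where "u j = nat (D - r j)" for j
  define M where "M = nat (D - x)"
  have "real (card N) \<le> (\<Sum>m=1..M. exp 1 * dens (D - int m))"
  proof (rule card_le_sum_density)
    show "finite N" using fin by (simp add: N_def)
    show "1 \<le> w" using False by simp
    show "1 \<le> u j \<and> u j \<le> M" if "j \<in> N" for j
      using that by (auto simp: N_def u_def M_def)
    show "0 \<le> dens (D - int m)" for m by (rule density_nonneg)
    show "real (card {j\<in>N. m \<le> u j \<and> u j \<le> L}) \<le> dens (D - int m) * real L"
      if "1 \<le> m" "m \<le> L" "L \<le> 2 * w" for m L
    proof -
      have "real (card {j\<in>N. m \<le> u j \<and> u j \<le> L})
          \<le> real (card {j\<in>{j\<in>J. r j \<le> D - int m}. D - int L \<le> r j \<and> d j \<le> D})"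
        using fin by (intro of_nat_mono card_mono) (auto simp: N_def u_def)
      also have "\<dots> \<le> dens (D - int m) * real_of_int (D - (D - int L))"
        using that by (intro density_ge) auto
      finally show ?thesis by simp
    qed
    \<comment> \<open>These jobs are released in [D - m - w, D - m], and their windows have length
      at most \<open>w\<close>, so an interval of length \<open>2 * w\<close> around
      \<open>D - m\<close> contains them.\<close>
    show "real (card {j\<in>N. m \<le> u j \<and> u j \<le> m + w}) \<le> dens (D - int m) * real (2 * w)"
      if "w < m" for m
    proof -
      have "real (card {j\<in>N. m \<le> u j \<and> u j \<le> m + w})
          \<le> real (card {j\<in>{j\<in>J. r j \<le> D - int m}.
              D - int m - int w \<le> r j \<and> d j \<le> D - int m + int w})"
        using fin short by (intro of_nat_mono card_mono) (force simp: N_def u_def)+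
      also have "\<dots> \<le> dens (D - int m) * real_of_int (D - int m + int w - (D - int m - int w))"
        using False by (intro density_ge) auto
      finally show ?thesis by simp
    qed
  qed
  also have "\<dots> \<le> (\<Sum>m=1..M. real (demand (D - int m)))"
    by (intro sum_mono) linarith
  also have "\<dots> = (\<Sum>v\<in>{x..<D}. real (demand v))"
    by (rule sum.reindex_bij_witness[of _ "\<lambda>v. nat (D - v)" "\<lambda>m. D - int m"])
      (auto simp: M_def)
  finally show ?thesis unfolding N_def of_nat_sum[symmetric] of_nat_le_iff .
qed

text \<open>At \<open>t = D\<close> the demand in \<open>backlog\<close> cancels against
  \<open>card_le_demand\<close>, leaving no unserved job.\<close>

sublocale timely_edf_run
proof
  fix D
  obtain x where "x \<le> D" "card ({j\<in>J. r j < D \<and> d j \<le> D} - served D) + (\<Sum>v\<in>{x..<D}. demand v)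
     \<le> card {j\<in>J. x \<le> r j \<and> r j < D \<and> d j \<le> D}"
    using backlog[of D D] by auto
  with card_le_demand[of x D] have "card ({j\<in>J. r j < D \<and> d j \<le> D} - served D) = 0" by simp
  then have "{j\<in>J. r j < D \<and> d j \<le> D} \<subseteq> served D"
    using fin by simp
  then show "{j\<in>J. d j \<le> D} \<subseteq> served D"
    using window by force
qed

lemma finite_starts: "finite {t. s t > 0}"
proof (rule finite_subset)
  show "{t. s t > 0} \<subseteq> {t. P t \<noteq> {}}" using start by auto
qed (rule finite_nonempty_P)

end

section \<open>Charging the starts for short jobs to a given solution\<close>

text \<open>
  A solution for the jobs with release times \<open>r j - lam\<close>: job \<open>j\<close> runs in slot \<open>y j\<close> of
  calibration \<open>\<kappa> j\<close>, and \<open>c k\<close> is the first calibrated slot of calibration \<open>k\<close>.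
\<close>

locale calibration_witness =
  fixes J :: "'a set" and r d :: "'a \<Rightarrow> int" and T :: nat
    and K :: "'k set" and c :: "'k \<Rightarrow> int" and \<kappa> :: "'a \<Rightarrow> 'k" and y :: "'a \<Rightarrow> int" and lam :: nat
  assumes finite_K: "finite K"
    and in_K: "j \<in> J \<Longrightarrow> \<kappa> j \<in> K"
    and in_cal: "j \<in> J \<Longrightarrow> c (\<kappa> j) \<le> y j \<and> y j < c (\<kappa> j) + int T"
    and in_window: "j \<in> J \<Longrightarrow> r j - int lam \<le> y j \<and> y j < d j"
    and slot_inj: "inj_on (\<lambda>j. (\<kappa> j, y j)) J"
begin

text \<open>
  Postponing a job by \<open>i \<le> lam\<close> slots to its shifted release time moves it into the copy of its
  calibration that is shifted by \<open>i\<close>.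
\<close>

lemma card_window_le:
  assumes "x < D" and window: "\<And>j. j \<in> J \<Longrightarrow> r j < d j"
  shows "card {j\<in>J. x \<le> r j \<and> d j \<le> D}
    \<le> (\<Sum>k\<in>K. \<Sum>i\<in>{..lam}. card ({c k + int i..<c k + int i + int T} \<inter> {x..<D}))"
proof -
  define S where "S = (SIGMA k:K. SIGMA i:{..lam}. {c k + int i..<c k + int i + int T} \<inter> {x..<D})"
  \<comment> \<open>The components are the calibration, the delay and the delayed slot; subtracting
    the delay recovers \<open>y j\<close>, so \<open>f\<close> inherits injectivity from
    \<open>slot_inj\<close>.\<close>
  define f where "f j = (\<kappa> j, nat (max (y j) (r j) - y j), max (y j) (r j))" for j
  have "card {j\<in>J. x \<le> r j \<and> d j \<le> D} \<le> card S"
  proof (rule card_inj_on_le)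
    show "inj_on f {j\<in>J. x \<le> r j \<and> d j \<le> D}"
    proof (rule inj_onI)
      fix i j assume *: "i \<in> {j\<in>J. x \<le> r j \<and> d j \<le> D}" "j \<in> {j\<in>J. x \<le> r j \<and> d j \<le> D}" "f i = f j"
      then have "\<kappa> i = \<kappa> j" "y i = y j" by (auto simp: f_def max_def split: if_splits)
      then show "i = j" using slot_inj * by (auto dest: inj_onD)
    qed
    show "f ` {j\<in>J. x \<le> r j \<and> d j \<le> D} \<subseteq> S"
    proof
      fix z assume "z \<in> f ` {j\<in>J. x \<le> r j \<and> d j \<le> D}"
      then obtain j where "j \<in> J" "x \<le> r j" "d j \<le> D" "z = f j" by auto
      with in_K[of j] in_cal[of j] in_window[of j] window[of j] show "z \<in> S"
        by (auto simp: S_def f_def max_def)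
    qed
    show "finite S" using finite_K by (auto simp: S_def)
  qed
  also have "card S = (\<Sum>k\<in>K. \<Sum>i\<in>{..lam}. card ({c k + int i..<c k + int i + int T} \<inter> {x..<D}))"
    unfolding S_def using finite_K by simp
  finally show ?thesis .
qed

lemma card_J_le: "card J \<le> card K * T"
proof -
  have "card J \<le> card (SIGMA k:K. {c k..<c k + int T})"
  proof (rule card_inj_on_le[OF slot_inj])
    show "(\<lambda>j. (\<kappa> j, y j)) ` J \<subseteq> (SIGMA k:K. {c k..<c k + int T})"
      using in_K in_cal by auto
    show "finite (SIGMA k:K. {c k..<c k + int T})" using finite_K by auto
  qed
  then show ?thesis using finite_K by simp
qed

end

locale short_run_witness = short_run + calibration_witness
begin

text \<open>The start times are covered by blocks of \<open>T\<close> slots. A block with last start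
  \<open>\<tau> b\<close> has at most \<open>exp 1 * dens (\<tau> b) + 1\<close> starts; the
  densities and the rounding terms are then summed separately.\<close>

lemma starts_le:
  "real (\<Sum>t | s t > 0. s t) \<le> (3 * exp 1 * (real lam + 1) + 2 + real lam) * real (card K)"
proof -
  define A where "A = {t. s t > 0}"
  obtain B where B: "B \<subseteq> A" "separated T B" "\<And>t. t \<in> A \<Longrightarrow> \<exists>b\<in>B. b \<le> t \<and> t < b + int T"
    using separated_cover_exists[OF _ T, of A] finite_starts unfolding A_def[symmetric] by blast
  have finA: "finite A" using finite_starts by (simp add: A_def)
  have finB: "finite B" using B(1) finA by (rule finite_subset)
  define \<tau> where "\<tau> b = Max {t\<in>A. b \<le> t \<and> t < b + int T}" for b
  have \<tau>: "\<tau> b \<in> A" "b \<le> \<tau> b" "\<tau> b < b + int T" "\<And>t. t \<in> A \<Longrightarrow> b \<le> t \<Longrightarrow> t < b + int T \<Longrightarrow> t \<le> \<tau> b"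
    if "b \<in> B" for b
  proof -
    have "finite {t\<in>A. b \<le> t \<and> t < b + int T}" "b \<in> {t\<in>A. b \<le> t \<and> t < b + int T}"
      using finA that B(1) T by auto
    then have "\<tau> b \<in> {t\<in>A. b \<le> t \<and> t < b + int T}"
      "\<And>t. t \<in> {t\<in>A. b \<le> t \<and> t < b + int T} \<Longrightarrow> t \<le> \<tau> b"
      unfolding \<tau>_def using Max_in by (blast, simp)
    then show "\<tau> b \<in> A" "b \<le> \<tau> b" "\<tau> b < b + int T"
      "\<And>t. t \<in> A \<Longrightarrow> b \<le> t \<Longrightarrow> t < b + int T \<Longrightarrow> t \<le> \<tau> b" by auto
  qed
  have block: "real (\<Sum>t\<in>{t\<in>A. b \<le> t \<and> t < b + int T}. s t) \<le> exp 1 * dens (\<tau> b) + 1"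
    if b: "b \<in> B" for b
  proof -
    have "(\<Sum>t\<in>{t\<in>A. b \<le> t \<and> t < b + int T}. s t) \<le> active T s (\<tau> b)"
      unfolding active_def using \<tau>[OF b] by (intro sum_mono2) force+
    \<comment> \<open>All starts of the block are still active at \<open>\<tau> b\<close>. As
      \<open>s (\<tau> b) > 0\<close>, the subtraction in the start rule is not truncated, so the
      active calibrations do not exceed the demand.\<close>
    also have "\<dots> \<le> demand (\<tau> b)"
      using active_split[OF T, of s "\<tau> b"] start[of "\<tau> b"] \<tau>(1)[OF b] by (simp add: A_def)
    finally have "real (\<Sum>t\<in>{t\<in>A. b \<le> t \<and> t < b + int T}. s t) \<le> real (demand (\<tau> b))"
      by (rule of_nat_mono)
    also have "\<dots> \<le> exp 1 * dens (\<tau> b) + 1"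
      using density_nonneg[of r d w "{j\<in>J. r j \<le> \<tau> b}" "\<tau> b"]
        ceiling_correct[of "exp 1 * dens (\<tau> b)"] by simp
    finally show ?thesis .
  qed
  let ?C = "\<lambda>k i. {c k + int i..<c k + int i + int T}"
  \<comment> \<open>The interval realizing the density is widened around \<open>\<tau> b\<close> by
    \<open>overlap_fraction_le\<close>, then to an interval of length \<open>3 * T\<close> that
    depends on \<open>b\<close> only.\<close>
  have dens_le: "dens (\<tau> b) \<le> (\<Sum>k\<in>K. \<Sum>i\<in>{..lam}. real (card (?C k i \<inter> {b - int T..<b + 2 * int T})) / real T)"
    if b: "b \<in> B" for b
  proof (cases rule: density_cases[of r d w "{j\<in>J. r j \<le> \<tau> b}" "\<tau> b"])
    case 1
    then show ?thesis by (auto intro!: sum_nonneg)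
  next
    case (2 x D)
    have "card {j\<in>{j\<in>J. r j \<le> \<tau> b}. x \<le> r j \<and> d j \<le> D} \<le> card {j\<in>J. x \<le> r j \<and> d j \<le> D}"
      using fin by (intro card_mono) auto
    also have "\<dots> \<le> (\<Sum>k\<in>K. \<Sum>i\<in>{..lam}. card (?C k i \<inter> {x..<D}))"
      using 2 window by (intro card_window_le) auto
    finally have "dens (\<tau> b) \<le> real (\<Sum>k\<in>K. \<Sum>i\<in>{..lam}. card (?C k i \<inter> {x..<D})) / real_of_int (D - x)"
      unfolding 2(4) using 2(1,2) by (intro divide_right_mono of_nat_mono) auto
    also have "\<dots> = (\<Sum>k\<in>K. \<Sum>i\<in>{..lam}. real (card (?C k i \<inter> {x..<D})) / real_of_int (D - x))"
      by (simp add: sum_divide_distrib)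
    also have "\<dots> \<le> (\<Sum>k\<in>K. \<Sum>i\<in>{..lam}. real (card (?C k i \<inter> {b - int T..<b + 2 * int T})) / real T)"
    proof (intro sum_mono)
      fix k i
      have "real (card (?C k i \<inter> {x..<D})) / real_of_int (D - x)
          \<le> real (card (?C k i \<inter> {\<tau> b - int T..<\<tau> b + int T})) / real T"
        using 2 w by (intro overlap_fraction_le) auto
      also have "\<dots> \<le> real (card (?C k i \<inter> {b - int T..<b + 2 * int T})) / real T"
        using \<tau>[OF b] by (intro divide_right_mono of_nat_mono card_mono) auto
      finally show "real (card (?C k i \<inter> {x..<D})) / real_of_int (D - x)
        \<le> real (card (?C k i \<inter> {b - int T..<b + 2 * int T})) / real T" .
    qed
    finally show ?thesis .
  qed
  \<comment> \<open>A slot lies in at most three of these intervals, since their left ends are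
    \<open>T\<close> apart.\<close>
  have cover: "(\<Sum>b\<in>B. card ({a..<a + int T} \<inter> {b - int T..<b + 2 * int T})) \<le> 3 * T" for a
  proof -
    have "(\<Sum>b\<in>B. card ({a..<a + int T} \<inter> {b - int T..<b + 2 * int T}))
        = (\<Sum>b\<in>B. \<Sum>z\<in>{a..<a + int T}. if z \<in> {b - int T..<b + 2 * int T} then 1 else 0)"
      by (simp add: sum.If_cases del: Int_atLeastLessThan atLeastLessThan_iff)
    also have "\<dots> = (\<Sum>z\<in>{a..<a + int T}. \<Sum>b\<in>B. if z \<in> {b - int T..<b + 2 * int T} then 1 else 0)"
      by (rule sum.swap)
    also have "\<dots> \<le> (\<Sum>z\<in>{a..<a + int T}. 3)"
    proof (rule sum_mono)
      fix z
      have "card {b\<in>B. z \<in> {b - int T..<b + 2 * int T}} \<le> 3"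
      proof (rule separated_card_le[OF _ T])
        show "separated T {b\<in>B. z \<in> {b - int T..<b + 2 * int T}}"
          using B(2) by (auto simp: separated_def)
        show "{b\<in>B. z \<in> {b - int T..<b + 2 * int T}} \<subseteq> {z - 2 * int T + 1..<z - 2 * int T + 1 + int 3 * int T}"
          by auto
      qed
      then show "(\<Sum>b\<in>B. if z \<in> {b - int T..<b + 2 * int T} then 1 else 0) \<le> (3::nat)"
        using finB by (simp add: sum.If_cases Int_def)
    qed
    finally show ?thesis by simp
  qed
  have sum_dens: "(\<Sum>b\<in>B. dens (\<tau> b)) \<le> 3 * (real lam + 1) * real (card K)"
  proof -
    have "(\<Sum>b\<in>B. dens (\<tau> b)) \<le> (\<Sum>b\<in>B. \<Sum>k\<in>K. \<Sum>i\<in>{..lam}. real (card (?C k i \<inter> {b - int T..<b + 2 * int T})) / real T)"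
      using dens_le by (rule sum_mono)
    also have "\<dots> = (\<Sum>k\<in>K. \<Sum>b\<in>B. \<Sum>i\<in>{..lam}. real (card (?C k i \<inter> {b - int T..<b + 2 * int T})) / real T)"
      by (rule sum.swap)
    also have "\<dots> = (\<Sum>k\<in>K. \<Sum>i\<in>{..lam}. \<Sum>b\<in>B. real (card (?C k i \<inter> {b - int T..<b + 2 * int T})) / real T)"
      by (intro sum.cong refl sum.swap)
    also have "\<dots> \<le> (\<Sum>k\<in>K. \<Sum>i\<in>{..lam}. 3)"
    proof (intro sum_mono)
      fix k i
      have "(\<Sum>b\<in>B. real (card (?C k i \<inter> {b - int T..<b + 2 * int T})) / real T)
          = real (\<Sum>b\<in>B. card (?C k i \<inter> {b - int T..<b + 2 * int T})) / real T"
        by (simp add: sum_divide_distrib)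
      also have "\<dots> \<le> real (3 * T) / real T"
        using cover by (intro divide_right_mono of_nat_mono) auto
      also have "\<dots> = 3" using T by simp
      finally show "(\<Sum>b\<in>B. real (card (?C k i \<inter> {b - int T..<b + 2 * int T})) / real T) \<le> 3" .
    qed
    also have "\<dots> = 3 * (real lam + 1) * real (card K)" by simp
    finally show ?thesis .
  qed
  \<comment> \<open>A job pending at \<open>b\<close> charges \<open>b\<close> to its calibration
    \<open>k\<close>. As its window is at most \<open>w\<close> long, \<open>b\<close> lies strictly
    between \<open>c k - w\<close> and \<open>c k + T + w + lam\<close>, a range of length at most
    \<open>(2 + lam) * T\<close>.\<close>
  have card_B: "card B \<le> (2 + lam) * card K"
  proof -
    have "\<exists>j. j \<in> P b" if "b \<in> B" for b
      using that B(1) start[of b] by (cases "P b = {}") (auto simp: A_def)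
    then obtain jb where jb: "\<And>b. b \<in> B \<Longrightarrow> jb b \<in> P b" by metis
    have "B = (\<Union>k\<in>K. {b\<in>B. \<kappa> (jb b) = k})"
      using jb P_alive in_K by blast
    then have "card B \<le> (\<Sum>k\<in>K. card {b\<in>B. \<kappa> (jb b) = k})"
      using card_UN_le[OF finite_K] by metis
    also have "\<dots> \<le> (\<Sum>k\<in>K. 2 + lam)"
    proof (rule sum_mono)
      fix k
      show "card {b\<in>B. \<kappa> (jb b) = k} \<le> 2 + lam"
      proof (rule separated_card_le[OF _ T])
        show "separated T {b\<in>B. \<kappa> (jb b) = k}" using B(2) by (auto simp: separated_def)
        have "lam \<le> lam * T" using T by simp
        then have wl: "int T + 2 * int w + int lam \<le> 2 * int T + int lam * int T"
          using w by (metis (mono_tags, lifting) add.assoc add_mono mult_2 of_nat_add of_nat_mono of_nat_mult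
              add_left_mono)
        show "{b\<in>B. \<kappa> (jb b) = k} \<subseteq> {c k - int w + 1..<c k - int w + 1 + int (2 + lam) * int T}"
        proof
          fix b assume b: "b \<in> {b\<in>B. \<kappa> (jb b) = k}"
          let ?j = "jb b"
          have j: "?j \<in> J" "r ?j \<le> b" "b < d ?j" "\<kappa> ?j = k" using jb[of b] P_alive[of ?j b] b by auto
          have "c k - int w < b" "b < c k + int T + int w + int lam"
            using in_cal[of ?j] in_window[of ?j] short[of ?j] j by auto
          then show "b \<in> {c k - int w + 1..<c k - int w + 1 + int (2 + lam) * int T}"
            using wl by (auto simp: algebra_simps)
        qed
      qed
    qed
    finally show ?thesis by (simp add: mult.commute)
  qed
  have "(\<Sum>t\<in>A. s t) \<le> (\<Sum>t\<in>A. \<Sum>b\<in>B. if b \<le> t \<and> t < b + int T then s t else 0)"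
  proof (rule sum_mono)
    fix t assume "t \<in> A"
    then obtain b where "b \<in> B" "b \<le> t" "t < b + int T" using B(3) by blast
    then show "s t \<le> (\<Sum>b\<in>B. if b \<le> t \<and> t < b + int T then s t else 0)"
      using finB member_le_sum[of b B "\<lambda>b. if b \<le> t \<and> t < b + int T then s t else 0"] by simp
  qed
  also have "\<dots> = (\<Sum>b\<in>B. \<Sum>t\<in>A. if b \<le> t \<and> t < b + int T then s t else 0)"
    by (rule sum.swap)
  also have "\<dots> = (\<Sum>b\<in>B. \<Sum>t\<in>{t\<in>A. b \<le> t \<and> t < b + int T}. s t)"
    using finA by (simp add: sum.If_cases Int_def)
  finally have "real (\<Sum>t\<in>A. s t) \<le> real (\<Sum>b\<in>B. \<Sum>t\<in>{t\<in>A. b \<le> t \<and> t < b + int T}. s t)"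
    by (rule of_nat_mono)
  also have "\<dots> = (\<Sum>b\<in>B. real (\<Sum>t\<in>{t\<in>A. b \<le> t \<and> t < b + int T}. s t))"
    by (rule of_nat_sum)
  also have "\<dots> \<le> (\<Sum>b\<in>B. exp 1 * dens (\<tau> b) + 1)" using block by (rule sum_mono)
  also have "\<dots> = exp 1 * (\<Sum>b\<in>B. dens (\<tau> b)) + real (card B)"
    by (simp add: sum.distrib sum_distrib_left)
  also have "\<dots> \<le> exp 1 * (3 * (real lam + 1) * real (card K)) + real ((2 + lam) * card K)"
    using sum_dens card_B by (intro add_mono mult_left_mono of_nat_mono) auto
  also have "\<dots> = (3 * exp 1 * (real lam + 1) + 2 + real lam) * real (card K)"
    by (simp add: algebra_simps)
  finally show ?thesis unfolding A_def .
qed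

end

section \<open>Jobs with long windows\<close>

definition capacity :: "nat \<Rightarrow> nat \<Rightarrow> (int \<Rightarrow> nat) \<Rightarrow> int \<Rightarrow> nat" where
  "capacity T h S t = (\<Sum>v\<in>{t..<t + int h}. active T S v)"

lemma capacity_hist_Suc:
  assumes "h \<le> T"
  shows "capacity T h (hist s (t + 1)) t = capacity T h (hist s t) t + h * s t"
proof -
  have "capacity T h (hist s (t + 1)) t = (\<Sum>v\<in>{t..<t + int h}. active T (hist s t) v + s t)"
    unfolding capacity_def using assms by (intro sum.cong) (auto simp: active_hist_Suc)
  then show ?thesis by (simp add: capacity_def sum.distrib)
qed

lemma sum_int_interval_split:
  fixes f :: "int \<Rightarrow> nat"
  assumes "a \<le> b" "b \<le> c"
  shows "(\<Sum>v\<in>{a..<c}. f v) = (\<Sum>v\<in>{a..<b}. f v) + (\<Sum>v\<in>{b..<c}. f v)"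
proof -
  have "{a..<c} = {a..<b} \<union> {b..<c}" using assms by auto
  then show ?thesis by (simp add: sum.union_disjoint)
qed

text \<open>The start rule is a division rounded up: the due jobs in excess of the capacity, over
  the \<open>h\<close> slots that one new calibration offers before \<open>t + h\<close>. Truncated
  subtraction yields no start if the due jobs fit.\<close>

locale long_run = edf_run +
  fixes h :: nat
  assumes h: "1 \<le> h" "h \<le> T"
    and long: "j \<in> J \<Longrightarrow> r j + int h \<le> d j"
    and start: "s t = (card {j\<in>P t. d j \<le> t + int h} - capacity T h (hist s t) t + (h - 1)) div h"
begin

abbreviation due :: "int \<Rightarrow> 'a set" where
  "due t \<equiv> {j\<in>P t. d j \<le> t + int h}"

lemma due_le_capacity: "card (due t) \<le> capacity T h (hist s (t + 1)) t"
proof -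
  define x where "x = card (due t) - capacity T h (hist s t) t"
  have "s t = (x + (h - 1)) div h" unfolding x_def by (rule start)
  moreover have "(x + (h - 1)) div h * h + (x + (h - 1)) mod h = x + (h - 1)"
    by (rule div_mult_mod_eq)
  moreover have "(x + (h - 1)) mod h < h" using h(1) by simp
  ultimately have "x + (h - 1) < h * s t + h" by (simp only: mult.commute)
  then have "x \<le> h * s t" using h(1) by linarith
  then show ?thesis unfolding capacity_hist_Suc[OF h(2)] x_def by linarith
qed

text \<open>Rounding up overshoots by less than one calibration, that is by fewer than
  \<open>h\<close> slots.\<close>

lemma capacity_less_due:
  assumes "s t > 0"
  shows "capacity T h (hist s (t + 1)) t < card (due t) + h"
proof -
  define x where "x = card (due t) - capacity T h (hist s t) t"
  have "h * s t \<le> x + (h - 1)"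
    using start[of t] unfolding x_def[symmetric] by simp
  moreover have "x > 0"
    using assms start[of t] h(1) unfolding x_def[symmetric] by (cases "x = 0") auto
  ultimately show ?thesis
    using h(1) unfolding capacity_hist_Suc[OF h(2)] x_def by linarith
qed

lemma due_nonempty:
  assumes "s t > 0"
  shows "due t \<noteq> {}"
proof
  assume "due t = {}"
  then have "card (due t) = 0" by (simp only: card.empty)
  moreover have "h * 1 \<le> h * s t" using assms by (intro mult_left_mono) auto
  ultimately show False
    using capacity_less_due[OF assms] unfolding capacity_hist_Suc[OF h(2)] by linarith
qed

text \<open>The condition at \<open>D = t + h\<close> is restored by the starts at \<open>t\<close>.
  For smaller \<open>D\<close> it is inherited: a slot either runs all jobs concerned or removes the
  same amount from both sides.\<close>

lemma pending_le_capacity: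
  "\<forall>D\<le>t + int h. card {j\<in>P t. d j \<le> D} \<le> (\<Sum>v\<in>{t..<D}. active T (hist s (t + 1)) v)"
proof (rule time_induct[OF fin, where r = r and t = t])
  fix t assume "\<And>j. j \<in> J \<Longrightarrow> t \<le> r j"
  then have "{j\<in>P t. d j \<le> D} = {}" if "D < t + int h" for D
    using that long by (force simp: pending_def)
  then have "card {j\<in>P t. d j \<le> D} = 0" if "D < t + int h" for D
    using that by (simp only: card.empty)
  note early = this
  show "\<forall>D\<le>t + int h. card {j\<in>P t. d j \<le> D} \<le> (\<Sum>v\<in>{t..<D}. active T (hist s (t + 1)) v)"
  proof (intro allI impI)
    fix D assume "D \<le> t + int h"
    then show "card {j\<in>P t. d j \<le> D} \<le> (\<Sum>v\<in>{t..<D}. active T (hist s (t + 1)) v)"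
      using due_le_capacity[of t] early[of D] unfolding capacity_def
      by (cases "D = t + int h") auto
  qed
next
  fix t
  assume IH: "\<forall>D\<le>t + int h. card {j\<in>P t. d j \<le> D} \<le> (\<Sum>v\<in>{t..<D}. active T (hist s (t + 1)) v)"
  show "\<forall>D\<le>t + 1 + int h. card {j\<in>P (t + 1). d j \<le> D}
      \<le> (\<Sum>v\<in>{t + 1..<D}. active T (hist s (t + 1 + 1)) v)"
  proof (intro allI impI)
    fix D assume D: "D \<le> t + 1 + int h"
    show "card {j\<in>P (t + 1). d j \<le> D} \<le> (\<Sum>v\<in>{t + 1..<D}. active T (hist s (t + 1 + 1)) v)"
    proof (cases "D = t + 1 + int h")
      case True
      then show ?thesis using due_le_capacity[of "t + 1"] by (simp add: capacity_def)
    next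
      case False
      let ?E = "{j\<in>P t. d j \<le> D}"
      \<comment> \<open>Here \<open>D < t + 1 + h\<close>, so a job released at \<open>t + 1\<close>
        with deadline at most \<open>D\<close> would have a window shorter than
        \<open>h\<close>.\<close>
      have E: "{j\<in>P (t + 1). d j \<le> D} = ?E - X t"
      proof -
        have "r j \<noteq> t + 1" if "j \<in> J" "d j \<le> D" for j using long[OF that(1)] that(2) D False by auto
        then show ?thesis by (force simp: pending_def served_Suc)
      qed
      have IHD: "card ?E \<le> (\<Sum>v\<in>{t..<D}. active T (hist s (t + 1)) v)"
        using IH D False by auto
      from edf_slot[of t D] show ?thesis
      proof
        assume "?E \<subseteq> X t"
        then have "card (?E - X t) = 0" by (metis Diff_eq_empty_iff card.empty)
        then show ?thesis unfolding E by simp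
      next
        assume *: "card (?E - X t) + active T s t = card ?E \<and> active T s t < card (P t)"
        show ?thesis
        proof (cases "D \<le> t")
          case True
          then show ?thesis unfolding E using * IHD by simp
        next
          case D': False
          then have "{t..<D} = insert t {t + 1..<D}" by auto
          then have "(\<Sum>v\<in>{t..<D}. active T (hist s (t + 1)) v)
              = active T s t + (\<Sum>v\<in>{t + 1..<D}. active T (hist s (t + 1)) v)"
            by (simp add: active_hist_self)
          moreover have "(\<Sum>v\<in>{t + 1..<D}. active T (hist s (t + 1)) v)
              \<le> (\<Sum>v\<in>{t + 1..<D}. active T (hist s (t + 1 + 1)) v)"
            using active_hist_Suc[of "t + 1" _ T s] by (intro sum_mono) simp
          ultimately show ?thesis unfolding E using * IHD by linarith
        qed
      qed
    qed
  qed
qed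

text \<open>For \<open>t = D\<close> the capacity in \<open>pending_le_capacity\<close> is an empty
  sum.\<close>

sublocale timely_edf_run
proof
  fix D
  have "card {j\<in>P D. d j \<le> D} \<le> (\<Sum>v\<in>{D..<D}. active T (hist s (D + 1)) v)"
    by (rule pending_le_capacity[rule_format]) simp
  then have "card {j\<in>P D. d j \<le> D} = 0" by simp
  then have "{j\<in>P D. d j \<le> D} = {}" using finite_P[of D] by simp
  then show "{j\<in>J. d j \<le> D} \<subseteq> served D"
    using window by (force simp: pending_def)
qed

lemma finite_starts: "finite {t. s t > 0}"
proof (rule finite_subset)
  show "{t. s t > 0} \<subseteq> {t. P t \<noteq> {}}" using due_nonempty by blast
qed (rule finite_nonempty_P)

section \<open>Potential argument for starts and wasted slots\<close>

text \<open>
  For a time \<open>p\<close> with a start, \<open>Idle p\<close> collects the slots before the next start in which some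
  active calibration is unused, and \<open>waste p\<close> fills them up to an interval beginning at \<open>p\<close>.
  A later start shows that the calibrations active at that moment are used for the next \<open>h\<close>
  slots, so only slots in \<open>waste p\<close> have to be paid for by the optimum.
\<close>

definition Idle :: "int \<Rightarrow> int set" where
  "Idle p = {v. p \<le> v \<and> (\<forall>q. s q > 0 \<longrightarrow> q \<le> p \<or> v < q) \<and> card (X v) < active T s v}"

definition waste :: "int \<Rightarrow> int set" where
  "waste p = {v. \<exists>u\<in>Idle p. p \<le> v \<and> v \<le> u}"

lemma Idle_before_next: "v \<in> Idle p \<Longrightarrow> s q > 0 \<Longrightarrow> q \<le> p \<or> v < q"
  by (simp add: Idle_def)

text \<open>A calibration active at \<open>v\<close> started at or before \<open>v\<close>, hence at
  or before \<open>p\<close> by the choice of \<open>Idle\<close>, and it lasts only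
  \<open>T\<close> slots.\<close>

lemma Idle_less: "v \<in> Idle p \<Longrightarrow> v < p + int T"
proof -
  assume v: "v \<in> Idle p"
  then have "active T s v \<noteq> 0" by (auto simp: Idle_def)
  then obtain u where "v - int T < u" "u \<le> v" "s u > 0"
    unfolding active_def by (auto simp: sum_eq_0_iff)
  with Idle_before_next[OF v, of u] show ?thesis by linarith
qed

lemma waste_subset: "waste p \<subseteq> {p..<p + int T}"
  using Idle_less by (force simp: waste_def)

lemma finite_waste: "finite (waste p)"
  using waste_subset by (rule finite_subset) simp

lemma card_waste_le: "card (waste p) \<le> T"
  using card_mono[OF _ waste_subset[of p]] by simp

lemma hist_eq:
  assumes "p < t" "\<And>q. p < q \<Longrightarrow> q < t \<Longrightarrow> s q = 0"
  shows "hist s t = hist s (p + 1)"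
  using assms by (force simp: hist_def)

text \<open>Processed jobs plus remaining capacity act as a potential that loses at most
  \<open>h / T\<close> per wasted slot until the next start; multiplying by \<open>T\<close> avoids
  fractions. Without idle slots, used capacity becomes processed jobs and nothing is lost.\<close>

lemma reign:
  assumes p: "s p > 0" "p < t" and none: "\<And>q. p < q \<Longrightarrow> q < t \<Longrightarrow> s q = 0"
  shows "T * capacity T h (hist s (p + 1)) p + T * card (served p)
    \<le> T * card (served t) + T * capacity T h (hist s t) t + h * card (waste p)"
proof -
  define F where "F v = active T (hist s (p + 1)) v" for v
  have act: "active T s v = F v" if "p \<le> v" "v < t" for v
    using hist_eq[of p "v + 1"] none that unfolding F_def by (subst active_hist_self[symmetric]) auto
  have cap_t: "capacity T h (hist s t) t = (\<Sum>v\<in>{t..<t + int h}. F v)"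
    using hist_eq[of p t] p none by (simp add: capacity_def F_def)
  have cap_p: "capacity T h (hist s (p + 1)) p = (\<Sum>v\<in>{p..<p + int h}. F v)"
    by (simp add: capacity_def F_def)
  have X_full: "card (X v) = F v" if "p \<le> v" "v < t" "\<not> card (X v) < active T s v" for v
    using that act X_card[of v] by auto
  show ?thesis
  proof (cases "\<exists>v\<in>{p..<t}. card (X v) < active T s v")
    case False
    then have "(\<Sum>v\<in>{p..<t}. card (X v)) = (\<Sum>v\<in>{p..<t}. F v)"
      using X_full by (intro sum.cong) auto
    then have "card (served t) + capacity T h (hist s t) t
        = card (served p) + (\<Sum>v\<in>{p..<t + int h}. F v)"
      using card_served[of p t] p(2) sum_int_interval_split[of p t "t + int h" F] cap_t by simp
    moreover have "(\<Sum>v\<in>{p..<p + int h}. F v) \<le> (\<Sum>v\<in>{p..<t + int h}. F v)"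
      using p(2) by (intro sum_mono2) auto
    ultimately have "capacity T h (hist s (p + 1)) p + card (served p)
        \<le> card (served t) + capacity T h (hist s t) t"
      using cap_p by simp
    then have "T * (capacity T h (hist s (p + 1)) p + card (served p))
        \<le> T * (card (served t) + capacity T h (hist s t) t)" by (rule mult_left_mono) simp
    then show ?thesis by (simp add: algebra_simps)
  next
    case True
    define V where "V = {v\<in>{p..<t}. card (X v) < active T s v}"
    have "V \<subseteq> {p..<t}" by (auto simp: V_def)
    then have V: "finite V" "V \<noteq> {}" using True by (auto simp: V_def intro: finite_subset)
    define u where "u = Max V"
    have "u \<in> V" using V by (simp add: u_def)
    then have u: "p \<le> u" "u < t" "card (X u) < active T s u" by (auto simp: V_def)
    have u_last: "\<not> card (X v) < active T s v" if "u < v" "v < t" for v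
    proof
      assume "card (X v) < active T s v"
      then have "v \<in> V" using that u by (simp add: V_def)
      then have "v \<le> u" using V by (simp add: u_def)
      then show False using that by simp
    qed
    have "q \<le> p \<or> u < q" if "s q > 0" for q
      using none[of q] that u(2) by (cases "p < q \<and> q < t") auto
    then have "u \<in> Idle p" using u by (simp add: Idle_def)
    then have sub: "{p..u} \<subseteq> waste p" by (auto simp: waste_def)
    \<comment> \<open>The number of slots from \<open>p\<close> up to the last idle slot
      \<open>u\<close> before \<open>t\<close>.\<close>
    define g where "g = u + 1 - p"
    have g: "1 \<le> g" "g \<le> int T" "g \<le> int (card (waste p))"
      using u Idle_less[OF \<open>u \<in> Idle p\<close>] card_mono[OF finite_waste sub] by (auto simp: g_def)
    \<comment> \<open>An idle slot clears everything released so far, in particular the jobs due at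
      \<open>p\<close>, which fall short of the capacity at \<open>p\<close> by less than
      \<open>h\<close>.\<close>
    have "served p \<union> due p \<subseteq> served (u + 1)"
      using idle_P_served[OF u(3)] served_mono[of p "u + 1"] u(1) by (force simp: pending_def)
    then have "card (served p \<union> due p) \<le> card (served (u + 1))"
      by (rule card_mono[OF finite_served])
    moreover have "card (served p \<union> due p) = card (served p) + card (due p)"
      using finite_served by (intro card_Un_disjoint) (use fin in \<open>auto simp: pending_def\<close>)
    ultimately have 1: "card (served p) + card (due p) \<le> card (served (u + 1))" by simp
    have "(\<Sum>v\<in>{u + 1..<t}. card (X v)) = (\<Sum>v\<in>{u + 1..<t}. F v)"
      using X_full u_last u(1) by (intro sum.cong) auto
    then have 2: "card (served t) + capacity T h (hist s t) t
        = card (served (u + 1)) + (\<Sum>v\<in>{u + 1..<t + int h}. F v)"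
      using card_served[of "u + 1" t] u(2) sum_int_interval_split[of "u + 1" t "t + int h" F] cap_t
      by simp
    \<comment> \<open>At least one calibration started at \<open>p\<close> remains active until
      \<open>p + T\<close>. This gives \<open>Z \<ge> min h (T - g)\<close>, which compensates
      \<open>h\<close> up to the loss \<open>h * g / T\<close>.\<close>
    have "(\<Sum>v\<in>{u + 1..<min (t + int h) (p + int T)}. 1) \<le> (\<Sum>v\<in>{u + 1..<t + int h}. F v)"
    proof (rule order_trans)
      show "(\<Sum>v\<in>{u + 1..<min (t + int h) (p + int T)}. 1)
          \<le> (\<Sum>v\<in>{u + 1..<min (t + int h) (p + int T)}. F v)"
        using active_hist_Suc[of p _ T s] p(1) u(1)
        by (intro sum_mono) (auto simp: F_def)
      show "(\<Sum>v\<in>{u + 1..<min (t + int h) (p + int T)}. F v) \<le> (\<Sum>v\<in>{u + 1..<t + int h}. F v)"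
        by (intro sum_mono2) auto
    qed
    moreover define Z where "Z = (\<Sum>v\<in>{u + 1..<t + int h}. F v)"
    ultimately have "nat (min (t + int h) (p + int T) - (u + 1)) \<le> Z" by simp
    then have 3: "min (int h) (int T - g) \<le> int Z"
      using u(2) unfolding g_def by linarith
    have 4: "int T * int h \<le> int T * int Z + int h * g"
    proof (cases "int h \<le> int T - g")
      case True
      then have "int h \<le> int Z" using 3 by simp
      then have "int T * int h \<le> int T * int Z" by (intro mult_left_mono) auto
      moreover have "0 \<le> int h * g" using g by simp
      ultimately show ?thesis by linarith
    next
      case False
      then have "int T - g \<le> int Z" using 3 by simp
      then have "int T * (int T - g) \<le> int T * int Z" by (intro mult_left_mono) auto
      moreover have "0 \<le> (int T - g) * (int T - int h)" using g h by (intro mult_nonneg_nonneg) auto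
      ultimately show ?thesis by (simp add: algebra_simps)
    qed
    have "int h * g \<le> int h * int (card (waste p))" using g by (intro mult_left_mono) auto
    with 4 have "int (T * h) \<le> int (T * Z + h * card (waste p))" by simp
    then have 5: "T * h \<le> T * Z + h * card (waste p)" by (simp only: of_nat_le_iff)
    have "T * (capacity T h (hist s (p + 1)) p + card (served p))
        \<le> T * (card (served t) + capacity T h (hist s t) t - Z + h)"
      using capacity_less_due[OF p(1)] 1 2 unfolding Z_def by (intro mult_left_mono) auto
    also have "\<dots> + T * Z = T * (card (served t) + capacity T h (hist s t) t) + T * h"
      using 2 unfolding Z_def by (simp add: algebra_simps)
    finally show ?thesis using 5 by (simp add: algebra_simps)
  qed
qed

text \<open>Induction over the starts: a start at \<open>p\<close> raises the capacity by
  \<open>h * s p\<close>, and \<open>reign\<close> carries the potential on to the next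
  start.\<close>

lemma potential:
  "T * h * (\<Sum>u | s u > 0 \<and> u < t. s u) \<le> T * card (served t) + T * capacity T h (hist s t) t
    + h * (\<Sum>p | s p > 0 \<and> p < t. card (waste p))"
proof (induction "card {u. s u > 0 \<and> u < t}" arbitrary: t rule: less_induct)
  case less
  have fin_t: "finite {u. s u > 0 \<and> u < t}" for t
    using finite_starts by (rule finite_subset[rotated]) auto
  show ?case
  proof (cases "{u. s u > 0 \<and> u < t} = {}")
    case True
    then show ?thesis by (simp del: Collect_empty_eq)
  next
    case False
    define p where "p = Max {u. s u > 0 \<and> u < t}"
    have "p \<in> {u. s u > 0 \<and> u < t}" unfolding p_def using fin_t False by (rule Max_in)
    then have p: "s p > 0" "p < t" by auto
    have p_max: "q \<le> p" if "s q > 0" "q < t" for q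
      unfolding p_def using fin_t that by (intro Max_ge) auto
    have ins: "{u. s u > 0 \<and> u < t} = insert p {u. s u > 0 \<and> u < p}"
      using p p_max by force
    have IH: "T * h * (\<Sum>u | s u > 0 \<and> u < p. s u) \<le> T * card (served p)
        + T * capacity T h (hist s p) p + h * (\<Sum>q | s q > 0 \<and> q < p. card (waste q))"
      by (rule less.hyps) (unfold ins, simp add: fin_t)
    have "T * capacity T h (hist s (p + 1)) p + T * card (served p)
        \<le> T * card (served t) + T * capacity T h (hist s t) t + h * card (waste p)"
    proof (rule reign[OF p])
      show "s q = 0" if "p < q" "q < t" for q
        using p_max[of q] that by (cases "s q = 0") auto
    qed
    with IH show ?thesis
      unfolding ins capacity_hist_Suc[OF h(2)] by (simp add: fin_t algebra_simps)
  qed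
qed

end

section \<open>Paying for wasted slots and for long jobs\<close>

locale long_run_witness = long_run + calibration_witness
begin

text \<open>Starts followed by idle slots are grouped by the given calibration of a job due at the
  start. In a group the last start wastes at most \<open>T\<close> slots; the others have disjoint
  waste inside a range of length at most \<open>T + h + lam\<close>.\<close>

lemma waste_le: "(\<Sum>p | s p > 0. card (waste p)) \<le> (3 + lam) * T * card K"
proof -
  define A where "A = {p. s p > 0 \<and> Idle p \<noteq> {}}"
  have finA: "finite A" unfolding A_def using finite_starts by (rule finite_subset[rotated]) auto
  define jb where "jb p = (SOME j. j \<in> due p)" for p
  have jb: "jb p \<in> due p" if "s p > 0" for p
    unfolding jb_def using due_nonempty[OF that] by (rule some_in_eq[THEN iffD2])
  have jb': "jb p \<in> J" "r (jb p) \<le> p" "d (jb p) \<le> p + int h" "jb p \<notin> served p" if "s p > 0" for p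
    using jb[OF that] by (auto simp: pending_def)
  have "(\<Sum>p | s p > 0. card (waste p)) = (\<Sum>p\<in>A. card (waste p))"
    using finite_starts by (intro sum.mono_neutral_right) (auto simp: A_def waste_def)
  also have "\<dots> = (\<Sum>k\<in>K. \<Sum>p\<in>{p\<in>A. \<kappa> (jb p) = k}. card (waste p))"
    using finA finite_K jb' in_K by (intro sum.group[symmetric]) (auto simp: A_def)
  also have "\<dots> \<le> (\<Sum>k\<in>K. (3 + lam) * T)"
  proof (rule sum_mono)
    fix k
    define G where "G = {p\<in>A. \<kappa> (jb p) = k}"
    have finG: "finite G" using finA by (simp add: G_def)
    have "(\<Sum>p\<in>G. card (waste p)) \<le> (3 + lam) * T"
    proof (cases "G = {}")
      case False
      define q where "q = Max G"
      have q: "q \<in> G" "\<And>p. p \<in> G \<Longrightarrow> p \<le> q" using False finG by (auto simp: q_def)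
      have disj: "waste p \<inter> waste p' = {}" if "p \<in> G" "p' \<in> G" "p \<noteq> p'" for p p'
      proof -
        have *: "waste a \<inter> waste b = {}" if "s b > 0" "a < b" for a b
        proof (rule ccontr)
          assume "waste a \<inter> waste b \<noteq> {}"
          then obtain v u where "u \<in> Idle a" "v \<le> u" "b \<le> v" by (auto simp: waste_def)
          then show False using Idle_before_next[of u a b] that by auto
        qed
        show ?thesis using that *[of p p'] *[of p' p] by (cases "p < p'") (auto simp: G_def A_def)
      qed
      \<comment> \<open>The job due at \<open>p\<close> runs in calibration \<open>k\<close> before
        \<open>p + h\<close>, which gives the left end. The job due at \<open>q\<close> is still
        unserved at \<open>q\<close>, hence released after each idle slot \<open>u\<close>; it also
        runs in \<open>k\<close>, which gives the right end.\<close>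
      have sub: "waste p \<subseteq> {c k - int h + 1..<c k + int T + int lam}" if p: "p \<in> G - {q}" for p
      proof
        fix v assume "v \<in> waste p"
        then obtain u where u: "u \<in> Idle p" "p \<le> v" "v \<le> u" by (auto simp: waste_def)
        have sp: "s p > 0" "s q > 0" "\<kappa> (jb p) = k" "\<kappa> (jb q) = k" "p < q"
          using p q(1) q(2)[of p] by (auto simp: G_def A_def)
        have "c k - int h < p"
          using in_cal[of "jb p"] in_window[of "jb p"] jb'[of p] sp by auto
        moreover have "u < r (jb q)"
        proof (rule ccontr)
          assume "\<not> u < r (jb q)"
          then have "jb q \<in> served (u + 1)"
            using idle_P_served[of u] u(1) jb'[OF sp(2)] by (auto simp: Idle_def)
          moreover have "u + 1 \<le> q" using Idle_before_next[OF u(1) sp(2)] sp(5) by auto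
          ultimately show False using served_mono[of "u + 1" q] jb'[OF sp(2)] by auto
        qed
        moreover have "r (jb q) < c k + int T + int lam"
          using in_cal[of "jb q"] in_window[of "jb q"] jb'[of q] sp by auto
        ultimately show "v \<in> {c k - int h + 1..<c k + int T + int lam}" using u by auto
      qed
      have "(\<Sum>p\<in>G. card (waste p)) = card (waste q) + (\<Sum>p\<in>G - {q}. card (waste p))"
        using finG q(1) by (rule sum.remove)
      also have "(\<Sum>p\<in>G - {q}. card (waste p)) = card (\<Union>p\<in>G - {q}. waste p)"
        using finG finite_waste disj by (intro card_UN_disjoint[symmetric]) auto
      also have "\<dots> \<le> card {c k - int h + 1..<c k + int T + int lam}"
        using sub by (intro card_mono) auto
      also have "\<dots> \<le> T + h + lam" by simp
      finally have "(\<Sum>p\<in>G. card (waste p)) \<le> card (waste q) + (T + h + lam)" by simp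
      also have "\<dots> \<le> T + (T + T + lam * T)"
        using card_waste_le[of q] h T by (intro add_mono) auto
      finally show ?thesis by (simp add: algebra_simps)
    qed simp
    then show "(\<Sum>p\<in>{p\<in>A. \<kappa> (jb p) = k}. card (waste p)) \<le> (3 + lam) * T" by (simp add: G_def)
  qed
  finally show ?thesis by (simp add: mult.commute)
qed

text \<open>Once all calibrations have expired, \<open>potential\<close> leaves the processed jobs,
  at most \<open>T * card K\<close>, and the waste. \<open>T \<le> 2 * h\<close> makes the former
  cost 2 and the latter costs \<open>3 + lam\<close> per calibration.\<close>

lemma starts_le:
  assumes "T \<le> 2 * h"
  shows "(\<Sum>t | s t > 0. s t) \<le> (5 + lam) * card K"
proof -
  define n where "n = (\<Sum>t | s t > 0. s t)"
  define t where "t = Max (insert 0 {t. s t > 0}) + int T + 1"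
  have late: "u < t - int T" if "s u > 0" for u
  proof -
    have "u \<le> Max (insert 0 {t. s t > 0})" using finite_starts that by (intro Max_ge) auto
    then show ?thesis by (simp add: t_def)
  qed
  then have "u < t" if "s u > 0" for u using late[OF that] by simp
  then have all: "{u. s u > 0 \<and> u < t} = {u. s u > 0}" by blast
  have "capacity T h (hist s t) t = 0"
    using late by (fastforce simp: capacity_def active_def hist_def)
  then have "T * h * n \<le> T * card (served t) + h * (\<Sum>p | s p > 0. card (waste p))"
    using potential[of t] unfolding all n_def by simp
  also have "card (served t) \<le> card J"
    using served_subset[of t] fin by (intro card_mono) auto
  also have "card J \<le> card K * T" by (rule card_J_le)
  also note waste_le
  finally have "T * h * n \<le> T * (card K * T) + h * ((3 + lam) * T * card K)" by simp
  also have "T * (card K * T) \<le> T * (card K * (2 * h))"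
    using assms by (intro mult_left_mono) auto
  also have "T * (card K * (2 * h)) + h * ((3 + lam) * T * card K) = T * h * ((5 + lam) * card K)"
    by (simp add: algebra_simps)
  finally have "T * h * n \<le> T * h * ((5 + lam) * card K)" by simp
  moreover have "0 < T * h" using T h(1) by simp
  ultimately have "n \<le> (5 + lam) * card K" by (simp only: nat_mult_le_cancel1)
  then show ?thesis by (simp only: n_def)
qed

end

section \<open>Online simulation\<close>

text \<open>Ties are broken by a fixed choice depending only on the arguments, which keeps the
  algorithm deterministic and causal.\<close>

definition edf :: "('a \<Rightarrow> int) \<Rightarrow> nat \<Rightarrow> 'a set \<Rightarrow> 'a set" where
  "edf d n P = (SOME X. X \<subseteq> P \<and> card X = min n (card P) \<and> (\<forall>x\<in>X. \<forall>y\<in>P - X. d x \<le> d y))"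

lemma edf_exists:
  fixes d :: "'a \<Rightarrow> int"
  assumes "finite P"
  shows "\<exists>X. X \<subseteq> P \<and> card X = min n (card P) \<and> (\<forall>x\<in>X. \<forall>y\<in>P - X. d x \<le> d y)"
proof (induction n)
  case 0
  show ?case by (intro exI[of _ "{}"]) simp
next
  case (Suc n)
  then obtain X where X: "X \<subseteq> P" "card X = min n (card P)" "\<forall>x\<in>X. \<forall>y\<in>P - X. d x \<le> d y" by blast
  show ?case
  proof (cases "card P \<le> n")
    case True
    then show ?thesis using X by (intro exI[of _ X]) auto
  next
    case False
    then have "X \<noteq> P" using X(2) by auto
    then have ne: "d ` (P - X) \<noteq> {}" using X(1) by auto
    have fin: "finite (d ` (P - X))" using assms by simp
    obtain y where y: "y \<in> P - X" "d y = Min (d ` (P - X))"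
      using Min_in[OF fin ne] by auto
    have le: "\<And>z. z \<in> P - X \<Longrightarrow> d y \<le> d z" using fin y(2) by simp
    show ?thesis
    proof (intro exI[of _ "insert y X"] conjI)
      show "card (insert y X) = min (Suc n) (card P)"
        using X(1,2) y(1) False assms finite_subset[OF X(1)] by simp
    qed (use X y le in auto)
  qed
qed

lemma edf_spec:
  assumes "finite P"
  shows "edf d n P \<subseteq> P \<and> card (edf d n P) = min n (card P)
    \<and> (\<forall>x\<in>edf d n P. \<forall>y\<in>P - edf d n P. d x \<le> d y)"
  unfolding edf_def by (rule someI_ex[OF edf_exists[OF assms]])

text \<open>
  The state before time \<open>t\<close>: the number of calibrations started at each earlier time and the set
  of processed jobs. The rule \<open>f\<close> sees the current time, the released jobs, the pending jobs and
  the earlier starts.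
\<close>

function sim :: "('a \<Rightarrow> int) \<Rightarrow> ('a \<Rightarrow> int) \<Rightarrow> nat \<Rightarrow> (int \<Rightarrow> 'a set \<Rightarrow> 'a set \<Rightarrow> (int \<Rightarrow> nat) \<Rightarrow> nat)
    \<Rightarrow> 'a set \<Rightarrow> int \<Rightarrow> (int \<Rightarrow> nat) \<times> 'a set" where
  "sim r d T f J t =
    (if finite J \<and> (\<exists>j\<in>J. r j < t)
     then let S = fst (sim r d T f J (t - 1)); C = snd (sim r d T f J (t - 1));
              P = pending r J C (t - 1);
              S' = S(t - 1 := f (t - 1) {j\<in>J. r j \<le> t - 1} P S)
          in (S', C \<union> edf d (active T S' (t - 1)) P)
     else (\<lambda>_. 0, {}))"
  by pat_completeness auto
termination
proof (relation "Wellfounded.measure (\<lambda>(r, d, T, f, J, t). nat (t - Min (r ` J)))", goal_cases)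
  case 1
  show ?case by simp
next
  case (2 r d T f J t)
  then obtain j where "finite J" "j \<in> J" "r j < t" by auto
  then have "Min (r ` J) < t" by (meson Min_le finite_imageI image_eqI le_less_trans)
  then show ?case by simp
next
  case (3 r d T f J t)
  then obtain j where "finite J" "j \<in> J" "r j < t" by auto
  then have "Min (r ` J) < t" by (meson Min_le finite_imageI image_eqI le_less_trans)
  then show ?case by simp
qed

declare sim.simps [simp del]

text \<open>By \<open>f_empty\<close> the step equation also holds before the first release, where
  \<open>sim\<close> returns its initial state.\<close>

locale online_rule =
  fixes r d :: "'a \<Rightarrow> int" and T :: nat
    and f :: "int \<Rightarrow> 'a set \<Rightarrow> 'a set \<Rightarrow> (int \<Rightarrow> nat) \<Rightarrow> nat"
  assumes T: "T \<ge> 1" and f_empty: "f t R {} S = 0"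
begin

definition starts :: "'a set \<Rightarrow> int \<Rightarrow> nat" where
  "starts J t = fst (sim r d T f J (t + 1)) t"

definition served :: "'a set \<Rightarrow> int \<Rightarrow> 'a set" where
  "served J t = snd (sim r d T f J t)"

definition proc :: "'a set \<Rightarrow> int \<Rightarrow> 'a set" where
  "proc J t = edf d (active T (fst (sim r d T f J (t + 1))) t) (pending r J (served J t) t)"

lemma sim_init: "(\<And>j. j \<in> J \<Longrightarrow> t \<le> r j) \<Longrightarrow> sim r d T f J t = (\<lambda>_. 0, {})"
  by (subst sim.simps) force

lemma edf_empty: "edf d n {} = {}"
  using edf_spec[of "{}" d n] by simp

lemma sim_Suc:
  assumes "finite J"
  shows "fst (sim r d T f J (t + 1)) = (fst (sim r d T f J t))
      (t := f t {j\<in>J. r j \<le> t} (pending r J (served J t) t) (fst (sim r d T f J t)))"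
    and "served J (t + 1) = served J t \<union> proc J t"
proof -
  let ?thesis1 = "fst (sim r d T f J (t + 1)) = (fst (sim r d T f J t))
      (t := f t {j\<in>J. r j \<le> t} (pending r J (served J t) t) (fst (sim r d T f J t)))"
  have "?thesis1 \<and> served J (t + 1) = served J t \<union> proc J t"
  proof (cases "\<exists>j\<in>J. r j < t + 1")
    case True
    then show ?thesis
      using assms sim.simps[of r d T f J "t + 1"] by (auto simp: served_def proc_def Let_def)
  next
    case False
    then have *: "sim r d T f J (t + 1) = (\<lambda>_. 0, {})" "sim r d T f J t = (\<lambda>_. 0, {})"
      by (force intro: sim_init)+
    have "pending r J C t = {}" for C using False by (force simp: pending_def)
    then show ?thesis by (simp add: * served_def proc_def f_empty edf_empty fun_eq_iff)
  qed
  then show ?thesis1 "served J (t + 1) = served J t \<union> proc J t" by auto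
qed

lemma sim_hist:
  assumes "finite J"
  shows "fst (sim r d T f J t) = hist (starts J) t"
proof (rule time_induct[OF assms, where r = r and t = t])
  fix t assume *: "\<And>j. j \<in> J \<Longrightarrow> t \<le> r j"
  have "starts J u = 0" if "u < t" for u
  proof -
    have "sim r d T f J (u + 1) = (\<lambda>_. 0, {})" using * that by (intro sim_init) force
    then show ?thesis by (simp add: starts_def)
  qed
  then show "fst (sim r d T f J t) = hist (starts J) t"
    using sim_init[OF *] by (auto simp: hist_def)
next
  fix t assume IH: "fst (sim r d T f J t) = hist (starts J) t"
  then have "fst (sim r d T f J (t + 1)) = (hist (starts J) t)(t := starts J t)"
    using sim_Suc(1)[OF assms, of t] by (simp add: starts_def fun_eq_iff)
  then show "fst (sim r d T f J (t + 1)) = hist (starts J) (t + 1)"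
    by (auto simp: hist_def fun_eq_iff)
qed

lemma starts_eq:
  assumes "finite J"
  shows "starts J t = f t {j\<in>J. r j \<le> t} (pending r J (served J t) t) (hist (starts J) t)"
  using sim_Suc(1)[OF assms, of t] sim_hist[OF assms, of t] by (simp add: starts_def)

lemma edf_run:
  assumes "finite J" "\<And>j. j \<in> J \<Longrightarrow> r j < d j"
  shows "edf_run J r d T (starts J) (served J) (proc J)"
proof
  have fin: "finite (pending r J (served J t) t)" for t using assms(1) by (simp add: pending_def)
  have proc: "proc J t = edf d (active T (starts J) t) (pending r J (served J t) t)" for t
    by (simp add: proc_def sim_hist[OF assms(1)] active_hist_self)
  show "served J t = {}" if "\<And>j. j \<in> J \<Longrightarrow> t \<le> r j" for t
    using sim_init[OF that] by (simp add: served_def)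
  show "proc J t \<subseteq> pending r J (served J t) t"
    "card (proc J t) = min (active T (starts J) t) (card (pending r J (served J t) t))" for t
    using edf_spec[OF fin] unfolding proc by blast+
  show "d x \<le> d y" if "x \<in> proc J t" "y \<in> pending r J (served J t) t - proc J t" for x y t
    using edf_spec[OF fin] that unfolding proc by blast
qed (use assms T sim_Suc(2) in auto)

text \<open>This makes the simulation online: rerunning it on the revealed jobs reproduces the state
  of the actual run.\<close>

lemma sim_causal:
  assumes "finite J" "finite J'"
  shows "{j\<in>J. r j < t} = {j\<in>J'. r j < t} \<longrightarrow> sim r d T f J t = sim r d T f J' t"
proof (rule time_induct[of "J \<union> J'", where r = r and t = t])
  show "finite (J \<union> J')" using assms by simp
  fix t assume "\<And>j. j \<in> J \<union> J' \<Longrightarrow> t \<le> r j"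
  then show "{j\<in>J. r j < t} = {j\<in>J'. r j < t} \<longrightarrow> sim r d T f J t = sim r d T f J' t"
    using sim_init[of J t] sim_init[of J' t] by auto
next
  fix t assume IH: "{j\<in>J. r j < t} = {j\<in>J'. r j < t} \<longrightarrow> sim r d T f J t = sim r d T f J' t"
  show "{j\<in>J. r j < t + 1} = {j\<in>J'. r j < t + 1} \<longrightarrow> sim r d T f J (t + 1) = sim r d T f J' (t + 1)"
  proof
    assume "{j\<in>J. r j < t + 1} = {j\<in>J'. r j < t + 1}"
    then have eq: "{j\<in>J. r j \<le> t} = {j\<in>J'. r j \<le> t}" by simp
    then have "{j\<in>J. r j < t} = {j\<in>J'. r j < t}" by force
    with IH have sim: "sim r d T f J t = sim r d T f J' t" by blast
    then have served: "served J t = served J' t" by (simp add: served_def)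
    have pend: "pending r J C t = pending r J' C t" for C using eq by (simp add: pending_def)
    have 1: "fst (sim r d T f J (t + 1)) = fst (sim r d T f J' (t + 1))"
      using sim_Suc(1)[OF assms(1), of t] sim_Suc(1)[OF assms(2), of t] eq sim served pend by simp
    then have "served J (t + 1) = served J' (t + 1)"
      using sim_Suc(2)[OF assms(1), of t] sim_Suc(2)[OF assms(2), of t] served pend
      by (simp add: proc_def)
    with 1 show "sim r d T f J (t + 1) = sim r d T f J' (t + 1)"
      by (simp add: served_def prod_eq_iff)
  qed
qed

lemma causal:
  assumes "finite J" "finite J'" "{j\<in>J. r j \<le> t} = {j\<in>J'. r j \<le> t}"
  shows "starts J t = starts J' t" "proc J t = proc J' t"
proof -
  have sim: "sim r d T f J (t + 1) = sim r d T f J' (t + 1)"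
    using sim_causal[OF assms(1,2), of "t + 1"] assms(3) by simp
  then show "starts J t = starts J' t" by (simp add: starts_def)
  have "{j\<in>J. r j < t} = {j\<in>J'. r j < t}" using assms(3) by force
  then have "served J t = served J' t"
    using sim_causal[OF assms(1,2), of t] by (simp add: served_def)
  then show "proc J t = proc J' t"
    using sim assms(3) by (simp add: proc_def pending_def)
qed

end

section \<open>From slots to machines\<close>

text \<open>
  Two classes of jobs are scheduled independently, and every calibration gets a machine of its
  own. The functions \<open>st\<close> and \<open>pr\<close> are indexed by the first calibrated slot, so a calibration
  with index \<open>u\<close> is started at time \<open>u - lam\<close>.
\<close>

locale slot_algorithm =
  fixes lam T :: nat and st :: "bool \<Rightarrow> job set \<Rightarrow> int \<Rightarrow> nat"
    and pr :: "bool \<Rightarrow> job set \<Rightarrow> int \<Rightarrow> job set"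
  assumes st_causal: "valid_instance lam J \<Longrightarrow> u \<le> t + int lam \<Longrightarrow> st b (revealed J t) u = st b J u"
    and pr_causal: "valid_instance lam J \<Longrightarrow> pr b (revealed J t) t = pr b J t"
    and finite_st: "valid_instance lam J \<Longrightarrow> finite {u. st b J u > 0}"
    and card_pr: "valid_instance lam J \<Longrightarrow> card (pr b J t) \<le> active T (st b J) t"
    and pr_window: "valid_instance lam J \<Longrightarrow> j \<in> pr b J t \<Longrightarrow>
      j \<in> J \<and> release j \<le> t \<and> t < deadline j"
    and pr_exists: "valid_instance lam J \<Longrightarrow> j \<in> J \<Longrightarrow> \<exists>b t. j \<in> pr b J t"
    and pr_unique: "valid_instance lam J \<Longrightarrow> j \<in> pr b J t \<Longrightarrow> j \<in> pr b' J t' \<Longrightarrow> b = b' \<and> t = t'"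
begin

definition machines :: "bool \<Rightarrow> job set \<Rightarrow> int \<Rightarrow> nat set" where
  "machines b J t = (\<lambda>(u, k). to_nat (b, u, k)) ` (SIGMA u:{t - int T<..t}. {..<st b J u})"

text \<open>A fixed injection, which exists by \<open>card_pr\<close>. It depends on
  \<open>J\<close> only through \<open>pr\<close> and \<open>machines\<close> at \<open>t\<close>,
  hence only on the revealed jobs.\<close>

definition assign :: "bool \<Rightarrow> job set \<Rightarrow> int \<Rightarrow> job \<Rightarrow> nat" where
  "assign b J t = (SOME g. inj_on g (pr b J t) \<and> g ` pr b J t \<subseteq> machines b J t)"

text \<open>A calibration started now is first usable at \<open>t + lam\<close>, which is the index
  consulted. By \<open>st_causal\<close> its count is already determined by the revealed
  jobs.\<close>

definition alg :: online_alg where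
  "alg t R = ({to_nat (b, t + int lam, k) | b k. k < st b R (t + int lam)},
     {(j, assign b R t j) | b j. j \<in> pr b R t})"

lemma assign_revealed:
  assumes "valid_instance lam J"
  shows "assign b (revealed J t) t = assign b J t"
proof -
  have "machines b (revealed J t) t = machines b J t"
    unfolding machines_def
    by (intro image_cong Sigma_cong refl) (use st_causal[OF assms] in auto)
  then show ?thesis by (simp add: assign_def pr_causal[OF assms])
qed

lemma assign:
  assumes J: "valid_instance lam J"
  shows "inj_on (assign b J t) (pr b J t) \<and> assign b J t ` pr b J t \<subseteq> machines b J t"
proof -
  have "finite J" using J by (simp add: valid_instance_def)
  then have fin: "finite (pr b J t)" by (rule finite_subset[rotated]) (use pr_window[OF J] in blast)
  have "card (machines b J t) = active T (st b J) t"
    unfolding machines_def active_def by (subst card_image) (auto simp: inj_on_def)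
  then have "card (pr b J t) \<le> card (machines b J t)" using card_pr[OF J] by simp
  moreover have "finite (machines b J t)" by (simp add: machines_def)
  ultimately have "\<exists>g. g ` pr b J t \<subseteq> machines b J t \<and> inj_on g (pr b J t)"
    using fin by (intro card_le_inj) auto
  then have "\<exists>g. inj_on g (pr b J t) \<and> g ` pr b J t \<subseteq> machines b J t" by blast
  then show ?thesis unfolding assign_def by (rule someI_ex)
qed

lemma cals_execute:
  assumes "valid_instance lam J"
  shows "cals (execute alg J) = (\<lambda>(b, u, k). (to_nat (b, u, k), u - int lam)) `
    (SIGMA b:UNIV. SIGMA u:{u. st b J u > 0}. {..<st b J u})"
proof -
  have "cals (execute alg J)
      = {(to_nat (b, t + int lam, k), t) | b t k. k < st b J (t + int lam)}"
    by (auto simp: execute_def alg_def st_causal[OF assms])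
  also have "\<dots> = (\<lambda>(b, u, k). (to_nat (b, u, k), u - int lam)) `
    (SIGMA b:UNIV. SIGMA u:{u. st b J u > 0}. {..<st b J u})" (is "?L = ?f ` ?S")
  proof (intro equalityI subsetI)
    fix x assume "x \<in> ?L"
    then obtain b t k where "x = (to_nat (b, t + int lam, k), t)" "k < st b J (t + int lam)" by auto
    then show "x \<in> ?f ` ?S" by (intro image_eqI[of _ _ "(b, t + int lam, k)"]) auto
  next
    fix x assume "x \<in> ?f ` ?S"
    then obtain b u k where "x = (to_nat (b, u, k), u - int lam)" "k < st b J u" by auto
    then have "x = (to_nat (b, u - int lam + int lam, k), u - int lam) \<and> k < st b J (u - int lam + int lam)"
      by simp
    then show "x \<in> ?L" by blast
  qed
  finally show ?thesis .
qed

lemma runs_execute: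
  assumes "valid_instance lam J"
  shows "(j, m, t) \<in> runs (execute alg J) \<longleftrightarrow> (\<exists>b. j \<in> pr b J t \<and> m = assign b J t j)"
  by (auto simp: execute_def alg_def pr_causal[OF assms] assign_revealed[OF assms])

lemma num_cals_execute:
  assumes "valid_instance lam J"
  shows "num_cals (execute alg J)
    = (\<Sum>u | st True J u > 0. st True J u) + (\<Sum>u | st False J u > 0. st False J u)"
proof -
  have "num_cals (execute alg J) = card (SIGMA b:(UNIV::bool set). SIGMA u:{u. st b J u > 0}. {..<st b J u})"
    unfolding num_cals_def cals_execute[OF assms] by (rule card_image) (auto simp: inj_on_def)
  also have "\<dots> = (\<Sum>b\<in>UNIV. \<Sum>u | st b J u > 0. st b J u)"
    using finite_st[OF assms] by simp
  finally show ?thesis by (simp add: UNIV_bool)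
qed

lemma solves: "solves_online lam T alg"
  unfolding solves_online_def
proof (intro allI impI)
  fix J assume J: "valid_instance lam J"
  show "feasible lam T J (execute alg J)"
    unfolding feasible_def
  proof (intro conjI)
    show "finite (cals (execute alg J))"
      unfolding cals_execute[OF J] using finite_st[OF J] by (intro finite_imageI finite_SigmaI) auto
    \<comment> \<open>\<open>to_nat\<close> is injective, so a machine number determines its only
      start time.\<close>
    show "\<forall>m s s'. (m, s) \<in> cals (execute alg J) \<longrightarrow> (m, s') \<in> cals (execute alg J) \<longrightarrow> s \<noteq> s' \<longrightarrow>
        occupied lam T s \<inter> occupied lam T s' = {}"
      unfolding cals_execute[OF J] by auto
    show "\<forall>(j, m, t) \<in> runs (execute alg J). j \<in> J \<and> release j \<le> t \<and> t + 1 \<le> deadline j \<and>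
        (\<exists>s. (m, s) \<in> cals (execute alg J) \<and> t \<in> calibrated lam T s)"
    proof clarify
      fix j m t assume "(j, m, t) \<in> runs (execute alg J)"
      then obtain b where b: "j \<in> pr b J t" "m = assign b J t j" by (auto simp: runs_execute[OF J])
      then have "m \<in> machines b J t" using assign[OF J] by blast
      then obtain u k where uk: "m = to_nat (b, u, k)" "t - int T < u" "u \<le> t" "k < st b J u"
        by (auto simp: machines_def)
      then have "(m, u - int lam) \<in> cals (execute alg J)"
        unfolding cals_execute[OF J] by (intro image_eqI[of _ _ "(b, u, k)"]) auto
      moreover have "t \<in> calibrated lam T (u - int lam)" using uk by (simp add: calibrated_def)
      ultimately show "j \<in> J \<and> release j \<le> t \<and> t + 1 \<le> deadline j \<and>
        (\<exists>s. (m, s) \<in> cals (execute alg J) \<and> t \<in> calibrated lam T s)"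
        using pr_window[OF J b(1)] by auto
    qed
    show "\<forall>j j' m t. (j, m, t) \<in> runs (execute alg J) \<longrightarrow> (j', m, t) \<in> runs (execute alg J) \<longrightarrow> j = j'"
    proof (intro allI impI)
      fix j j' m t assume "(j, m, t) \<in> runs (execute alg J)" "(j', m, t) \<in> runs (execute alg J)"
      then obtain b b' where b: "j \<in> pr b J t" "m = assign b J t j" "j' \<in> pr b' J t" "m = assign b' J t j'"
        by (auto simp: runs_execute[OF J])
      then have "m \<in> machines b J t" "m \<in> machines b' J t" using assign[OF J] by blast+
      then have "b = b'" by (auto simp: machines_def)
      then show "j = j'" using b assign[OF J, of b t] by (auto dest: inj_onD)
    qed
    show "\<forall>j\<in>J. \<exists>!(m, t). (j, m, t) \<in> runs (execute alg J)"
    proof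
      fix j assume "j \<in> J"
      then obtain b t where "j \<in> pr b J t" using pr_exists[OF J] by blast
      then show "\<exists>!(m, t). (j, m, t) \<in> runs (execute alg J)"
        by (intro ex1I[of _ "(assign b J t j, t)"])
          (auto simp: runs_execute[OF J] dest: pr_unique[OF J])
    qed
  qed
qed

end

section \<open>Comparison with an optimal schedule and combination of the classes\<close>

lemma feasible_witness:
  assumes "feasible lam T J S"
  obtains \<kappa> y where
    "calibration_witness J (\<lambda>j. release j + int lam) deadline T (cals S) (\<lambda>(m, s). s + int lam) \<kappa> y lam"
proof -
  have "\<exists>k t. k \<in> cals S \<and> (j, fst k, t) \<in> runs S \<and> release j \<le> t \<and> t < deadline j
      \<and> snd k + int lam \<le> t \<and> t < snd k + int lam + int T" if "j \<in> J" for j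
  proof -
    from assms that have "\<exists>!(m, t). (j, m, t) \<in> runs S" by (auto simp: feasible_def)
    then obtain m t where mt: "(j, m, t) \<in> runs S" by auto
    with assms have "release j \<le> t \<and> t + 1 \<le> deadline j
        \<and> (\<exists>s. (m, s) \<in> cals S \<and> t \<in> calibrated lam T s)"
      by (auto simp: feasible_def)
    with mt show ?thesis by (force simp: calibrated_def)
  qed
  then obtain \<kappa> y where w: "\<And>j. j \<in> J \<Longrightarrow> \<kappa> j \<in> cals S \<and> (j, fst (\<kappa> j), y j) \<in> runs S \<and> release j \<le> y j
      \<and> y j < deadline j \<and> snd (\<kappa> j) + int lam \<le> y j \<and> y j < snd (\<kappa> j) + int lam + int T"
    by metis
  have "calibration_witness J (\<lambda>j. release j + int lam) deadline T (cals S) (\<lambda>(m, s). s + int lam) \<kappa> y lam"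
  proof
    show "finite (cals S)" using assms by (simp add: feasible_def)
    show "inj_on (\<lambda>j. (\<kappa> j, y j)) J"
    proof (rule inj_onI)
      fix i j assume *: "i \<in> J" "j \<in> J" "(\<kappa> i, y i) = (\<kappa> j, y j)"
      then have "(i, fst (\<kappa> j), y j) \<in> runs S" "(j, fst (\<kappa> j), y j) \<in> runs S"
        using w[of i] w[of j] by auto
      then show "i = j" using assms unfolding feasible_def by blast
    qed
  qed (use w in \<open>auto simp: split_beta\<close>)
  then show ?thesis by (rule that)
qed

lemma calibration_witness_subset:
  assumes "calibration_witness J r d T K c \<kappa> y lam" "J' \<subseteq> J"
  shows "calibration_witness J' r d T K c \<kappa> y lam"
proof -
  interpret calibration_witness J r d T K c \<kappa> y lam by fact
  show ?thesis
    using assms(2) finite_K in_K in_cal in_window slot_inj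
    by unfold_locales (auto intro: inj_on_subset)
qed

definition short_rule :: "('a \<Rightarrow> int) \<Rightarrow> ('a \<Rightarrow> int) \<Rightarrow> nat \<Rightarrow> nat
    \<Rightarrow> int \<Rightarrow> 'a set \<Rightarrow> 'a set \<Rightarrow> (int \<Rightarrow> nat) \<Rightarrow> nat" where
  "short_rule r d T w t R P S = min (nat \<lceil>exp 1 * density r d w R t\<rceil>) (card P) - active T S t"

definition long_rule :: "('a \<Rightarrow> int) \<Rightarrow> nat \<Rightarrow> nat
    \<Rightarrow> int \<Rightarrow> 'a set \<Rightarrow> 'a set \<Rightarrow> (int \<Rightarrow> nat) \<Rightarrow> nat" where
  "long_rule d T h t R P S = (card {j\<in>P. d j \<le> t + int h} - capacity T h S t + (h - 1)) div h"

text \<open>The classes contribute \<open>3 * exp 1 * (lam + 1) + 2 + lam\<close> and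
  \<open>5 + lam\<close> per optimal calibration. The resulting \<open>2 * lam\<close> is bounded by
  \<open>3 * lam\<close>, and the additive constant is 0.\<close>

theorem competitive_algorithm_exists:
  fixes lam T :: nat
  assumes T: "T \<ge> 1"
  shows "\<exists>A. solves_online lam T A \<and>
    competitive lam T (3 * (exp 1 + 1) * real lam + 3 * exp 1 + 7) A"
proof -
  \<comment> \<open>This gives \<open>2 * w \<le> T\<close> for the short jobs and
    \<open>T \<le> 2 * h\<close> with \<open>h = w + 1\<close> for the long ones.\<close>
  define w where "w = T div 2"
  define r where "r j = release j + int lam" for j :: job
  define f :: "bool \<Rightarrow> int \<Rightarrow> job set \<Rightarrow> job set \<Rightarrow> (int \<Rightarrow> nat) \<Rightarrow> nat"
    where "f b = (if b then short_rule r deadline T w else long_rule deadline T (w + 1))" for b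
  define part where "part b J = {j\<in>J. (deadline j \<le> r j + int w) = b}" for b J
  interpret rule: online_rule r deadline T "f b" for b
    by unfold_locales (use T in \<open>auto simp: f_def short_rule_def long_rule_def\<close>)
  define st where "st b J = rule.starts b (part b J)" for b J
  define pr where "pr b J = rule.proc b (part b J)" for b J
  have fin_part: "finite (part b J)" if "valid_instance lam J" for b J
    using that by (simp add: part_def valid_instance_def)
  have run: "edf_run (part b J) r deadline T (st b J) (rule.served b (part b J)) (pr b J)"
    if "valid_instance lam J" for b J
    unfolding st_def pr_def using fin_part[OF that]
    by (rule rule.edf_run) (use that in \<open>force simp: part_def valid_instance_def r_def\<close>)
  have short: "short_run (part True J) r deadline T (st True J) (rule.served True (part True J)) (pr True J) w"
    if "valid_instance lam J" for J
  proof -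
    interpret edf_run "part True J" r deadline T "st True J" "rule.served True (part True J)" "pr True J"
      by (rule run[OF that])
    show ?thesis
      using rule.starts_eq[OF fin_part[OF that], of True True]
      by unfold_locales (auto simp: w_def part_def st_def f_def short_rule_def)
  qed
  have long: "long_run (part False J) r deadline T (st False J) (rule.served False (part False J)) (pr False J) (w + 1)"
    if "valid_instance lam J" for J
  proof -
    interpret edf_run "part False J" r deadline T "st False J" "rule.served False (part False J)" "pr False J"
      by (rule run[OF that])
    show ?thesis
      using rule.starts_eq[OF fin_part[OF that], of False False] T
      by unfold_locales (auto simp: w_def part_def st_def f_def long_rule_def)
  qed
  have timely: "timely_edf_run (part b J) r deadline T (st b J) (rule.served b (part b J)) (pr b J)"
    if "valid_instance lam J" for b J
  proof (cases b)
    case True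
    interpret short_run "part True J" r deadline T "st True J" "rule.served True (part True J)" "pr True J" w
      by (rule short[OF that])
    have "timely_edf_run (part True J) r deadline T (st True J) (rule.served True (part True J)) (pr True J)"
      by unfold_locales
    then show ?thesis using True by simp
  next
    case False
    interpret long_run "part False J" r deadline T "st False J" "rule.served False (part False J)" "pr False J" "w + 1"
      by (rule long[OF that])
    have "timely_edf_run (part False J) r deadline T (st False J) (rule.served False (part False J)) (pr False J)"
      by unfold_locales
    then show ?thesis using False by simp
  qed
  have finite_st: "finite {u. st b J u > 0}" if "valid_instance lam J" for b J
    using short_run.finite_starts[OF short[OF that]] long_run.finite_starts[OF long[OF that]]
    by (cases b) auto
  \<comment> \<open>A job with shifted release time at most \<open>t + lam\<close> was released by
    time \<open>t\<close>; this turns causality of the simulation into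
    \<open>st_causal\<close>.\<close>
  have part_revealed: "{j\<in>part b (revealed J t). r j \<le> u} = {j\<in>part b J. r j \<le> u}"
    if "u \<le> t + int lam" for b J t u
    using that by (auto simp: part_def revealed_def r_def)
  have valid_revealed: "valid_instance lam (revealed J t)" if "valid_instance lam J" for J t
    using that by (auto simp: valid_instance_def revealed_def)
  interpret slot_algorithm lam T st pr
  proof
    fix J b assume J: "valid_instance lam J"
    interpret t: timely_edf_run "part b J" r deadline T "st b J" "rule.served b (part b J)" "pr b J" for b
      by (rule timely[OF J])
    show "st b (revealed J t) u = st b J u" if "u \<le> t + int lam" for t u
      unfolding st_def using that
      by (intro rule.causal(1) fin_part J valid_revealed part_revealed)
    show "pr b (revealed J t) t = pr b J t" for t
      unfolding pr_def by (intro rule.causal(2) fin_part J valid_revealed part_revealed) simp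
    show "finite {u. st b J u > 0}" by (rule finite_st[OF J])
    show "card (pr b J t) \<le> active T (st b J) t" for t using t.X_card[of b t] by simp
    show "j \<in> J \<and> release j \<le> t \<and> t < deadline j" if "j \<in> pr b J t" for j t
      using t.X_alive[OF that] by (auto simp: part_def r_def)
    show "\<exists>b t. j \<in> pr b J t" if "j \<in> J" for j
      using that t.X_exists[of j "deadline j \<le> r j + int w"] by (auto simp: part_def)
    show "b = b' \<and> t = t'" if "j \<in> pr b J t" "j \<in> pr b' J t'" for j b' t t'
    proof -
      have "b = b'" using t.X_alive[OF that(1)] t.X_alive[OF that(2)] by (auto simp: part_def)
      then show ?thesis using that t.X_unique by blast
    qed
  qed
  have "real (num_cals (execute alg J))
      \<le> (3 * (exp 1 + 1) * real lam + 3 * exp 1 + 7) * real (opt lam T J) + 0"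
    if J: "valid_instance lam J" for J
  proof -
    obtain S where S: "feasible lam T J S" "num_cals S = opt lam T J"
      using opt_attained[OF J T] by blast
    obtain \<kappa> y where wit: "calibration_witness J r deadline T (cals S) (\<lambda>(m, s). s + int lam) \<kappa> y lam"
      using feasible_witness[OF S(1)] unfolding r_def by blast
    have wit': "calibration_witness (part b J) r deadline T (cals S) (\<lambda>(m, s). s + int lam) \<kappa> y lam" for b
      using wit by (rule calibration_witness_subset) (auto simp: part_def)
    have opt: "card (cals S) = opt lam T J" using S(2) by (simp add: num_cals_def)
    interpret s: short_run_witness "part True J" r deadline T "st True J" "rule.served True (part True J)"
        "pr True J" w "cals S" "\<lambda>(m, s). s + int lam" \<kappa> y lam
      by (intro short_run_witness.intro short[OF J] wit')
    interpret l: long_run_witness "part False J" r deadline T "st False J" "rule.served False (part False J)"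
        "pr False J" "w + 1" "cals S" "\<lambda>(m, s). s + int lam" \<kappa> y lam
      by (intro long_run_witness.intro long[OF J] wit')
    have "(\<Sum>u | st False J u > 0. st False J u) \<le> (5 + lam) * opt lam T J"
      using l.starts_le by (simp add: w_def opt)
    then have "real (\<Sum>u | st False J u > 0. st False J u) \<le> real ((5 + lam) * opt lam T J)"
      by (rule of_nat_mono)
    also have "\<dots> = (5 + real lam) * real (opt lam T J)" by simp
    finally have "real (\<Sum>u | st False J u > 0. st False J u) \<le> (5 + real lam) * real (opt lam T J)" .
    then have "real (num_cals (execute alg J))
        \<le> (3 * exp 1 * (real lam + 1) + 2 + real lam) * real (opt lam T J)
          + (5 + real lam) * real (opt lam T J)"
      using s.starts_le unfolding num_cals_execute[OF J] opt by simp
    also have "\<dots> = (3 * exp 1 * real lam + 2 * real lam + 3 * exp 1 + 7) * real (opt lam T J)"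
      by (simp add: algebra_simps)
    also have "\<dots> \<le> (3 * (exp 1 + 1) * real lam + 3 * exp 1 + 7) * real (opt lam T J)"
      by (intro mult_right_mono) (auto simp: algebra_simps)
    finally show ?thesis by simp
  qed
  then have "competitive lam T (3 * (exp 1 + 1) * real lam + 3 * exp 1 + 7) alg"
    unfolding competitive_def by blast
  with solves show ?thesis by blast
qed

theorem theorem3:
  fixes lam T :: nat
  assumes "T \<ge> 1"
  shows "(\<exists>A. solves_online lam T A \<and>
            competitive lam T (3 * (exp 1 + 1) * real lam + 3 * exp 1 + 7) A) \<and>
         (\<exists>A. solves_online 0 T A \<and> competitive 0 T (3 * exp 1 + 7) A)"
  using competitive_algorithm_exists[OF assms, of lam] competitive_algorithm_exists[OF assms, of 0]
  by simp

end
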